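(* Let $n\ge1$, $s\in(0,1)$, let $\Omega\subset\mathbb R^n$ be a bounded open set with Lipschitz boundary, and let $q\in(1,c_{n,s})$, where $c_{n,s}$ is such that $s_q\in(s,1)$ and $s_qq<1$. Let $u:\mathbb R^n\to\mathbb R$ be such that $u\in\mathcal W^{s_q,q}(\Omega)$ and $$\operatorname{Tail}_s^1(u,\cdot),\ \operatorname{Tail}_{s_q}^q(u,\cdot)\in L^1(\Omega).$$ Then $$\lim_{p\to1}\mathcal E_p^{s_p}(u,\Omega)=\mathcal E_1^s(u,\Omega).$$
   Context: For $p\ge1$, $s_p:=n+s-\frac np$ (so $s_1=s$ and $n+s_pp=(n+s)p$); $p\to1$ means $p\to1^+$. $\mathcal W^{r,p}(\Omega)$ is the set of $u:\mathbb R^n\to\mathbb R$ (measurable) with $u|_\Omega\in L^p(\Omega)$ and $\int_\Omega\int_\Omega\frac{|u(x)-u(y)|^p}{|x-y|^{n+rp}}dxdy<+\infty$. For $x\in\Omega$, $\operatorname{Tail}_{s_p}^p(u,x)=\int_{\mathbb R^n\setminus\Omega}\frac{|u(y)|^p}{|x-y|^{(n+s)p}}dy$; in particular $\operatorname{Tail}_s^1(u,x)=\int_{\mathbb R^n\setminus\Omega}\frac{|u(y)|}{|x-y|^{n+s}}dy$. $\mathcal E_p^r(u,\Omega)=\frac1{2p}\iint_{Q(\Omega)}\frac{|u(x)-u(y)|^p}{|x-y|^{n+rp}}dxdy$ with $Q(\Omega)=\mathbb R^{2n}\setminus(\mathbb R^n\setminus\Omega)^2$. *)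

theory Defs
  imports "HOL-Analysis.Analysis"
begin

text \<open>
  Near each boundary point the set lies strictly on one side of the graph, in some direction
  \<open>e\<close>, of a Lipschitz function on the hyperplane orthogonal to \<open>e\<close>; this replaces a rotation of
  the coordinate axes. In dimension one the hyperplane is \<open>{0}\<close> and the condition says that the
  set is a half-line near the point.
\<close>

definition lipschitz_boundary :: "'a::euclidean_space set \<Rightarrow> bool" where
  "lipschitz_boundary \<Omega> \<longleftrightarrow>
     (\<forall>x\<in>frontier \<Omega>. \<exists>r>0. \<exists>e. norm e = 1 \<and>
        (\<exists>(L::real) (\<phi>::'a \<Rightarrow> real). L-lipschitz_on {v. v \<bullet> e = 0} \<phi> \<and>
          \<Omega> \<inter> ball x r = {y \<in> ball x r. y \<bullet> e > \<phi> (y - (y \<bullet> e) *\<^sub>R e)}))"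

definition s_exp :: "nat \<Rightarrow> real \<Rightarrow> real \<Rightarrow> real" where
  "s_exp n s p = real n + s - real n / p"

text \<open>
  The value at \<open>x = y\<close> is \<open>0 / 0 = 0\<close> for positive \<open>p\<close>; the diagonal is a null set anyway.
\<close>

definition gagliardo_kernel ::
    "real \<Rightarrow> real \<Rightarrow> ('a::euclidean_space \<Rightarrow> real) \<Rightarrow> 'a \<Rightarrow> 'a \<Rightarrow> real" where
  "gagliardo_kernel r p u x y =
     \<bar>u x - u y\<bar> powr p / norm (x - y) powr (real DIM('a) + r * p)"

definition W_space ::
    "real \<Rightarrow> real \<Rightarrow> 'a::euclidean_space set \<Rightarrow> ('a \<Rightarrow> real) set" where
  "W_space r p \<Omega> = {u. u \<in> borel_measurable lebesgue \<and>
     set_integrable lebesgue \<Omega> (\<lambda>x. \<bar>u x\<bar> powr p) \<and>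
     (\<integral>\<^sup>+x\<in>\<Omega>. (\<integral>\<^sup>+y\<in>\<Omega>. ennreal (gagliardo_kernel r p u x y) \<partial>lebesgue) \<partial>lebesgue) < \<infinity>}"

text \<open>
  For \<open>r = s_exp n s p\<close> and \<open>p \<noteq> 0\<close> the exponent \<open>n + r * p\<close> equals \<open>(n + s) * p\<close>.
\<close>

definition Tail ::
    "real \<Rightarrow> real \<Rightarrow> 'a::euclidean_space set \<Rightarrow> ('a \<Rightarrow> real) \<Rightarrow> 'a \<Rightarrow> ennreal" where
  "Tail r p \<Omega> u x =
     (\<integral>\<^sup>+y\<in>-\<Omega>. ennreal (\<bar>u y\<bar> powr p / norm (x - y) powr (real DIM('a) + r * p)) \<partial>lebesgue)"

definition L1_on :: "'a::euclidean_space set \<Rightarrow> ('a \<Rightarrow> ennreal) set" where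
  "L1_on \<Omega> = {f. f \<in> borel_measurable (restrict_space lebesgue \<Omega>) \<and>
     (\<integral>\<^sup>+x\<in>\<Omega>. f x \<partial>lebesgue) < \<infinity>}"

definition Q_set :: "'a set \<Rightarrow> ('a \<times> 'a) set" where
  "Q_set \<Omega> = UNIV - (UNIV - \<Omega>) \<times> (UNIV - \<Omega>)"

definition energy ::
    "real \<Rightarrow> real \<Rightarrow> ('a::euclidean_space \<Rightarrow> real) \<Rightarrow> 'a set \<Rightarrow> ennreal" where
  "energy r p u \<Omega> = ennreal (1 / (2 * p)) *
     (\<integral>\<^sup>+z\<in>Q_set \<Omega>. ennreal (gagliardo_kernel r p u (fst z) (snd z)) \<partial>lebesgue)"

end

theory Submission
  imports Defs
begin

text \<open>
Write \<open>g(x,y) = \<bar>u x - u y\<bar> / norm (x - y) powr (n + s)\<close>. The exponent \<open>s\<^sub>p\<close> is chosen such that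
\<open>n + s\<^sub>p p = (n + s) p\<close>, so the kernel of the energy with exponent \<open>p\<close> is exactly \<open>g powr p\<close>, and the
theorem asks for \<open>\<integral> g powr p \<rightarrow> \<integral> g\<close> over \<open>Q = Q(\<Omega>)\<close> as \<open>p\<close> decreases to \<open>1\<close>. On \<open>g < 1\<close> this is monotone
convergence, and on \<open>g \<ge> 1\<close> it is dominated convergence with majorant \<open>g powr q\<close>
(\<open>nn_integral_powr_tendsto\<close>). Everything therefore reduces to \<open>\<integral> g powr q < \<infinity>\<close> over \<open>Q\<close>
(\<open>nn_integral_Q_set_finite\<close>).

On \<open>\<Omega> \<times> \<Omega>\<close> this is membership of \<open>u\<close> in the fractional Sobolev space. On \<open>\<Omega> \<times> - \<Omega>\<close> one has
\<open>\<bar>u x - u y\<bar> powr q \<le> 2 powr q * (\<bar>u x\<bar> powr q + \<bar>u y\<bar> powr q)\<close>. The second summand gives the tail with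
exponent \<open>q\<close>. In the first, put \<open>a = s\<^sub>q q < 1\<close> and let \<open>d x\<close> be the distance of \<open>x\<close> to the complement of \<open>\<Omega>\<close>;
integrating the kernel over \<open>- \<Omega>\<close> gives at most a multiple of \<open>d x powr (-a)\<close>. So what is needed is a
fractional Hardy inequality (\<open>fractional_hardy\<close>): \<open>\<bar>u\<bar> powr q * d powr (-a)\<close> is integrable over \<open>\<Omega>\<close>. This is
where the Lipschitz boundary and \<open>a < 1\<close> enter.

The Hardy inequality is proved by absorption. Near the boundary, compare \<open>u x\<close> with the values \<open>u y\<close> on a
ball around the point reached from \<open>x\<close> by a jump of length \<open>M * d x\<close> into \<open>\<Omega>\<close>, of radius comparable with
\<open>M * d x\<close>. The differences \<open>u x - u y\<close> are paid by the Gagliardo seminorm. In the remaining term, exchange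
the order of integration: the points \<open>x\<close> that may jump to a given \<open>y\<close> have \<open>d x\<close> comparable with \<open>d y / M\<close>, so
they lie in a layer of that thickness along the boundary and of width comparable with \<open>d y\<close>. Such a layer
has volume at most a multiple of \<open>(d y) ^ n / M\<close>, because \<open>M\<close> disjoint translates of it fit into a ball of
radius comparable with \<open>d y\<close> (\<open>thin_layer_emeasure\<close>). Hence this term is at most a multiple of
\<open>M powr (a - 1)\<close> times the Hardy integral itself (\<open>jump_averaging\<close>). As \<open>a < 1\<close>, a large \<open>M\<close> makes that factor
small enough to be absorbed, first for the integral truncated to \<open>d > \<eta>\<close>, which is finite, and then for
\<open>\<eta> \<rightarrow> 0\<close>.
\<close>

section \<open>Powers of a function as the exponent tends to one\<close>

text \<open>
The limit integral may be infinite: the part where \<open>h < 1\<close> increases to its limit, and only the part where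
\<open>h \<ge> 1\<close> needs the integrable power.
\<close>

lemma nn_integral_powr_tendsto:
  fixes h :: "'b \<Rightarrow> real"
  assumes h [measurable]: "h \<in> borel_measurable M" and nonneg: "\<And>x. 0 \<le> h x"
    and q: "1 < q" and fin: "(\<integral>\<^sup>+x. ennreal (h x powr q) \<partial>M) < \<infinity>"
  shows "((\<lambda>p. \<integral>\<^sup>+x. ennreal (h x powr p) \<partial>M) \<longlongrightarrow> (\<integral>\<^sup>+x. ennreal (h x) \<partial>M)) (at_right 1)"
proof (rule tendsto_at_right_sequentially[OF q])
  fix S :: "nat \<Rightarrow> real"
  assume S: "\<And>k. 1 < S k" "\<And>k. S k < q" "decseq S" "S \<longlonglongrightarrow> 1"
  let ?lo = "{x \<in> space M. h x < 1}" and ?hi = "{x \<in> space M. 1 \<le> h x}"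
  have pointwise: "(\<lambda>k. h x powr S k) \<longlonglongrightarrow> h x" for x
  proof (cases "h x = 0")
    case False
    then have "(\<lambda>k. h x powr S k) \<longlonglongrightarrow> h x powr 1"
      by (intro tendsto_intros S) auto
    then show ?thesis using nonneg[of x] by simp
  qed simp
  have split: "(\<integral>\<^sup>+x. ennreal (f x) \<partial>M) =
      (\<integral>\<^sup>+x. ennreal (f x) * indicator ?lo x \<partial>M) + (\<integral>\<^sup>+x. ennreal (f x) * indicator ?hi x \<partial>M)"
    if [measurable]: "f \<in> borel_measurable M" for f :: "'b \<Rightarrow> real"
    by (subst nn_integral_add[symmetric]) (auto intro!: nn_integral_cong simp: indicator_def)
  \<comment> \<open>Where \<open>h < 1\<close>, lowering the exponent raises the power, so monotone convergence applies.\<close>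
  have "(\<lambda>k. \<integral>\<^sup>+x. ennreal (h x powr S k) * indicator ?lo x \<partial>M)
      \<longlonglongrightarrow> (\<integral>\<^sup>+x. ennreal (h x) * indicator ?lo x \<partial>M)"
  proof (rule nn_integral_LIMSEQ)
    show "incseq (\<lambda>k x. ennreal (h x powr S k) * indicator ?lo x)"
      using S(3) nonneg
      by (auto simp: incseq_def decseq_def le_fun_def indicator_def intro!: ennreal_leI powr_mono')
    show "(\<lambda>k. ennreal (h x powr S k) * indicator ?lo x) \<longlonglongrightarrow> ennreal (h x) * indicator ?lo x" for x
      using pointwise by (auto simp: indicator_def intro!: tendsto_ennrealI)
  qed simp_all
  \<comment> \<open>Where \<open>h \<ge> 1\<close>, the integrable power \<open>h powr q\<close> dominates.\<close>
  moreover have "(\<lambda>k. \<integral>\<^sup>+x. ennreal (h x powr S k) * indicator ?hi x \<partial>M)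
      \<longlonglongrightarrow> (\<integral>\<^sup>+x. ennreal (h x) * indicator ?hi x \<partial>M)"
  proof (rule nn_integral_dominated_convergence[where w = "\<lambda>x. ennreal (h x powr q)"])
    show "AE x in M. ennreal (h x powr S k) * indicator ?hi x \<le> ennreal (h x powr q)" for k
      using S(2)[of k] by (auto simp: indicator_def intro!: AE_I2 ennreal_leI powr_mono)
    show "AE x in M. (\<lambda>k. ennreal (h x powr S k) * indicator ?hi x)
        \<longlonglongrightarrow> ennreal (h x) * indicator ?hi x"
      using pointwise by (auto simp: indicator_def intro!: AE_I2 tendsto_ennrealI)
  qed (use fin in simp_all)
  ultimately show "(\<lambda>k. \<integral>\<^sup>+x. ennreal (h x powr S k) \<partial>M) \<longlonglongrightarrow> (\<integral>\<^sup>+x. ennreal (h x) \<partial>M)"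
    by (subst (1 2) split) (auto intro!: tendsto_add)
qed

text \<open>
The exponents \<open>s\<^sub>p\<close> are made for this identity: all the energies integrate powers of one function.
\<close>

lemma gagliardo_kernel_s_exp:
  fixes u :: "'a::euclidean_space \<Rightarrow> real"
  assumes "p \<noteq> 0"
  shows "gagliardo_kernel (s_exp DIM('a) s p) p u x y = gagliardo_kernel s 1 u x y powr p"
proof -
  have "real DIM('a) + s_exp DIM('a) s p * p = (real DIM('a) + s) * p"
    using assms by (simp add: s_exp_def field_simps)
  then show ?thesis
    by (simp add: gagliardo_kernel_def powr_divide powr_powr)
qed

section \<open>Height functions at a Lipschitz boundary\<close>

text \<open>
The height \<open>t y = y \<bullet> e - \<phi> (y - (y \<bullet> e) *\<^sub>R e)\<close> above the graph carries all that is used of a chart: it is Lipschitz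
on the whole space, grows at unit speed along \<open>e\<close>, and its sign detects \<open>\<Omega>\<close> near \<open>z\<close>.
\<close>

lemma lipschitz_boundary_chart:
  fixes \<Omega> :: "'a::euclidean_space set"
  assumes "lipschitz_boundary \<Omega>" "z \<in> frontier \<Omega>"
  obtains r \<Lambda> e and t :: "'a \<Rightarrow> real" where "0 < r" "1 \<le> \<Lambda>" "norm e = 1"
    "\<And>x y. \<bar>t x - t y\<bar> \<le> \<Lambda> * dist x y" "\<And>x \<tau>. t (x + \<tau> *\<^sub>R e) = t x + \<tau>"
    "\<And>y. y \<in> ball z r \<Longrightarrow> y \<in> \<Omega> \<longleftrightarrow> 0 < t y"
proof -
  obtain r e L and \<phi> :: "'a \<Rightarrow> real" where r: "0 < r" and e: "norm e = 1"
    and L: "L-lipschitz_on {v. v \<bullet> e = 0} \<phi>"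
    and graph: "\<Omega> \<inter> ball z r = {y \<in> ball z r. y \<bullet> e > \<phi> (y - (y \<bullet> e) *\<^sub>R e)}"
    using bspec[OF assms(1)[unfolded lipschitz_boundary_def] assms(2)]
    by (elim exE conjE) (rule that)
  have ee: "e \<bullet> e = 1" using e by (simp add: dot_square_norm)
  define P where "P y = y - (y \<bullet> e) *\<^sub>R e" for y
  define t where "t y = y \<bullet> e - \<phi> (P y)" for y
  have "0 \<le> L" using L by (rule lipschitz_on_nonneg)
  have P: "P y \<bullet> e = 0" for y by (simp add: P_def inner_diff_left ee)
  have proj: "norm (w - (w \<bullet> e) *\<^sub>R e) \<le> norm w" for w
  proof (rule power2_le_imp_le)
    have "(norm (w - (w \<bullet> e) *\<^sub>R e))\<^sup>2 = w \<bullet> w - 2 * (w \<bullet> e) * (w \<bullet> e) + (w \<bullet> e) * (w \<bullet> e) * (e \<bullet> e)"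
      by (simp only: power2_norm_eq_inner inner_diff_left inner_diff_right inner_scaleR_left
          inner_scaleR_right inner_commute[of e w]) (simp only: algebra_simps)
    also have "\<dots> = (norm w)\<^sup>2 - (w \<bullet> e)\<^sup>2"
      by (simp add: e dot_square_norm power2_eq_square[of "w \<bullet> e"])
    finally show "(norm (w - (w \<bullet> e) *\<^sub>R e))\<^sup>2 \<le> (norm w)\<^sup>2" by simp
  qed simp
  have dP: "dist (P x) (P y) \<le> dist x y" for x y
  proof -
    have "P x - P y = (x - y) - ((x - y) \<bullet> e) *\<^sub>R e"
      by (simp add: P_def inner_diff_left scaleR_diff_left)
    then show ?thesis unfolding dist_norm by (simp only: proj)
  qed
  show thesis
  proof (rule that[of r "1 + L" e t])
    show "\<bar>t x - t y\<bar> \<le> (1 + L) * dist x y" for x y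
    proof -
      have "\<bar>x \<bullet> e - y \<bullet> e\<bar> \<le> dist x y"
        using Cauchy_Schwarz_ineq2[of "x - y" e] e by (simp add: inner_diff_left dist_norm)
      moreover have "\<bar>\<phi> (P x) - \<phi> (P y)\<bar> \<le> L * dist (P x) (P y)"
        using lipschitz_onD[OF L, of "P x" "P y"] P by (simp add: dist_real_def)
      moreover have "L * dist (P x) (P y) \<le> L * dist x y"
        using dP \<open>0 \<le> L\<close> by (rule mult_left_mono)
      ultimately show ?thesis unfolding t_def distrib_right mult_1 by linarith
    qed
    show "t (x + \<tau> *\<^sub>R e) = t x + \<tau>" for x \<tau>
    proof -
      have "P (x + \<tau> *\<^sub>R e) = P x" by (simp add: P_def inner_add_left e dot_square_norm scaleR_add_left)
      then show ?thesis by (simp add: t_def inner_add_left e dot_square_norm)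
    qed
    show "y \<in> \<Omega> \<longleftrightarrow> 0 < t y" if "y \<in> ball z r" for y
    proof -
      have "y \<in> \<Omega> \<longleftrightarrow> y \<in> \<Omega> \<inter> ball z r" using that by simp
      also have "\<dots> \<longleftrightarrow> 0 < t y" unfolding graph using that by (simp add: t_def P_def)
      finally show ?thesis .
    qed
  qed (use r e \<open>0 \<le> L\<close> in auto)
qed

text \<open>
A layer of thickness \<open>\<tau>\<close> occupies at most the fraction \<open>1 / M\<close> of a ball that is large enough for \<open>M\<close> steps of
length \<open>\<tau>\<close>: the translates of the layer by multiples of \<open>\<tau>\<close> in the direction \<open>e\<close> are disjoint. Such a packing
argument replaces Fubini in coordinates adapted to \<open>e\<close>.
\<close>

lemma thin_layer_emeasure:
  fixes t :: "'a::euclidean_space \<Rightarrow> real"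
  assumes L [measurable]: "L \<in> sets borel" and t: "\<And>x \<tau>. t (x + \<tau> *\<^sub>R e) = t x + \<tau>" and e: "norm e = 1"
    and layer: "\<And>x. x \<in> L \<Longrightarrow> 0 < t x \<and> t x \<le> \<tau>" and LR: "L \<subseteq> ball y R" and "0 \<le> \<tau>"
  shows "of_nat M * emeasure lborel L \<le> emeasure lborel (ball y (R + M * \<tau>))"
proof -
  \<comment> \<open>\<open>T j\<close> is \<open>L\<close> moved up by \<open>j * \<tau>\<close>; on it \<open>t\<close> takes values in \<open>(j * \<tau>, (j + 1) * \<tau>]\<close>.\<close>
  define v where "v j = (- (real j * \<tau>)) *\<^sub>R e" for j
  define T where "T j = (+) (v j) -` L" for j
  have T [measurable]: "T j \<in> sets lborel" for j
  proof -
    have "(+) (v j) -` L \<inter> space borel \<in> sets borel"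
      by (rule measurable_sets[OF _ L]) measurable
    then show ?thesis by (simp add: T_def)
  qed
  have eT: "emeasure lborel (T j) = emeasure lborel L" for j
  proof -
    have "emeasure lborel L = emeasure (distr lborel borel ((+) (v j))) L"
      by (simp add: lborel_distr_plus)
    then show ?thesis by (simp add: emeasure_distr T_def)
  qed
  have tT: "real j * \<tau> < t x \<and> t x \<le> real (Suc j) * \<tau>" if "x \<in> T j" for x j
    using layer[of "v j + x"] that t[of x "- (real j * \<tau>)"]
    by (auto simp: T_def v_def algebra_simps)
  have "disjoint_family_on T {..<M}"
    unfolding disjoint_family_on_def
  proof (intro ballI impI equals0I)
    fix i j x assume "i \<noteq> j" "x \<in> T i \<inter> T j"
    then have *: "real i * \<tau> < t x" "t x \<le> real (Suc i) * \<tau>" "real j * \<tau> < t x" "t x \<le> real (Suc j) * \<tau>"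
      using tT by auto
    have step: "real (Suc k) * \<tau> \<le> real l * \<tau>" if "k < l" for k l
      using that \<open>0 \<le> \<tau>\<close> by (intro mult_right_mono) auto
    have "real (Suc i) * \<tau> \<le> real j * \<tau> \<or> real (Suc j) * \<tau> \<le> real i * \<tau>"
      using \<open>i \<noteq> j\<close> step[of i j] step[of j i] by linarith
    with * show False by linarith
  qed
  then have "of_nat M * emeasure lborel L = emeasure lborel (\<Union>j<M. T j)"
    by (subst sum_emeasure[symmetric]) (use T in \<open>auto simp: eT\<close>)
  also have "\<dots> \<le> emeasure lborel (ball y (R + M * \<tau>))"
  proof (rule emeasure_mono)
    show "(\<Union>j<M. T j) \<subseteq> ball y (R + M * \<tau>)"
    proof
      fix x assume "x \<in> (\<Union>j<M. T j)"
      then obtain j where j: "j < M" "x \<in> T j" by auto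
      let ?x = "v j + x"
      have "dist y ?x < R" using LR j by (auto simp: T_def)
      moreover have "dist y x \<le> dist y ?x + dist ?x x" by (rule dist_triangle)
      moreover have "dist ?x x = real j * \<tau>" using e \<open>0 \<le> \<tau>\<close> by (simp add: dist_norm v_def)
      moreover have "real j * \<tau> \<le> M * \<tau>" using j \<open>0 \<le> \<tau>\<close> by (intro mult_right_mono) auto
      ultimately show "x \<in> ball y (R + M * \<tau>)" by simp
    qed
  qed simp
  finally show ?thesis .
qed

lemma infdist_Compl_pos:
  fixes \<Omega> :: "'a::euclidean_space set"
  assumes "bounded \<Omega>" "open \<Omega>" "x \<in> \<Omega>"
  shows "0 < infdist x (- \<Omega>)"
proof -
  have "- \<Omega> \<noteq> {}" using assms(1) not_bounded_UNIV by (metis double_complement Compl_empty_eq)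
  then have "infdist x (- \<Omega>) \<noteq> 0" using in_closed_iff_infdist_zero[of "- \<Omega>" x] assms by auto
  then show ?thesis using infdist_nonneg[of x "- \<Omega>"] by linarith
qed

lemma infdist_borel_measurable [measurable]:
  "(\<lambda>x::'a::euclidean_space. infdist x S) \<in> borel_measurable borel"
  by (intro borel_measurable_continuous_onI continuous_intros)

section \<open>Jumping away from the boundary\<close>

text \<open>
A point \<open>z\<close> outside \<open>\<Omega>\<close> with a height function \<open>t\<close> as produced by \<open>lipschitz_boundary_chart\<close>; throughout, \<open>d\<close> is
the depth of a point in \<open>\<Omega>\<close>.
\<close>

locale boundary_chart =
  fixes \<Omega> :: "'a::euclidean_space set" and z e :: 'a and r \<Lambda> :: real and t :: "'a \<Rightarrow> real"
  assumes r: "0 < r" and Lam: "1 \<le> \<Lambda>" and e: "norm e = 1" and z: "z \<notin> \<Omega>"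
    and lip: "\<And>x y. \<bar>t x - t y\<bar> \<le> \<Lambda> * dist x y"
    and shift: "\<And>x \<tau>. t (x + \<tau> *\<^sub>R e) = t x + \<tau>"
    and chart: "\<And>y. y \<in> ball z r \<Longrightarrow> y \<in> \<Omega> \<longleftrightarrow> 0 < t y"
begin

abbreviation d :: "'a \<Rightarrow> real" where "d x \<equiv> infdist x (- \<Omega>)"

text \<open>
By the Lipschitz bound, the height above the graph is at most \<open>\<Lambda>\<close> times the distance to any point where
\<open>t \<le> 0\<close>. For \<open>y\<close> within half the radius, points beyond the chart are no closer than \<open>z\<close> itself.
\<close>

lemma height_le_infdist:
  assumes y: "y \<in> ball z (r/2)"
  shows "t y \<le> \<Lambda> * d y"
proof -
  have ne: "- \<Omega> \<noteq> {}" using z by auto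
  have "t y / \<Lambda> \<le> infdist y (- \<Omega>)"
    unfolding infdist_notempty[OF ne]
  proof (rule cINF_greatest[OF ne])
    fix w assume w: "w \<in> - \<Omega>"
    have "t y \<le> \<Lambda> * dist y w"
    proof (cases "w \<in> ball z r")
      case True
      then have "t w \<le> 0" using chart w by fastforce
      then show ?thesis using lip[of y w] by linarith
    next
      case False
      have "dist y z < r/2" using y by (simp add: dist_commute)
      moreover have "r \<le> dist w z" using False by (simp add: dist_commute)
      moreover have "dist w z \<le> dist y w + dist y z" by (metis dist_commute dist_triangle)
      ultimately have "dist y z \<le> dist y w" by linarith
      then have "\<Lambda> * dist y z \<le> \<Lambda> * dist y w" using Lam by (intro mult_left_mono) auto
      moreover have "t z \<le> 0" using chart[of z] z r by simp
      ultimately show ?thesis using lip[of y z] by linarith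
    qed
    then show "t y / \<Lambda> \<le> dist y w" using Lam by (simp add: field_simps)
  qed
  then show ?thesis using Lam by (simp add: field_simps)
qed

text \<open>
The pairs \<open>(x, y)\<close> with \<open>x \<in> A\<close> for which \<open>y\<close> is an admissible target of \<open>x\<close>: it lies near the point at distance
\<open>M * d x\<close> above \<open>x\<close>. With the tolerance \<open>M * d x / (2 * \<Lambda>)\<close> the height of \<open>y\<close> is still at least half of the
length of the jump.
\<close>

definition jump :: "nat \<Rightarrow> 'a set \<Rightarrow> ('a \<times> 'a) set" where
  "jump M A = {w. fst w \<in> A \<and>
     dist (fst w + (real M * d (fst w)) *\<^sub>R e) (snd w) < real M * d (fst w) / (2 * \<Lambda>)}"

text \<open>
Start and target are comparable at scale \<open>M\<close>: the depth is multiplied by a factor between \<open>M / (2 * \<Lambda>)\<close> and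
\<open>3 * M\<close>. The bound on \<open>d x\<close> keeps the target inside the chart.
\<close>

lemma jump_geometry:
  assumes w: "(x, y) \<in> jump M A" and A: "A \<subseteq> \<Omega> \<inter> ball z (r/4)" and M: "2 * \<Lambda> \<le> real M"
    and small: "0 < d x" "d x \<le> r / (8 * real M)"
  shows "dist x y < 2 * real M * d x" "y \<in> \<Omega>" "d x \<le> 2 * \<Lambda> / real M * d y" "d x \<le> d y" "d y \<le> 3 * real M * d x"
    "0 < t x" "t x \<le> \<Lambda> * d x"
proof -
  define c where "c = x + (real M * d x) *\<^sub>R e"
  have x: "x \<in> A" "x \<in> \<Omega>" "dist z x < r/4" and cy: "dist c y < real M * d x / (2 * \<Lambda>)"
    using w A by (auto simp: jump_def c_def)
  have M0: "0 < real M" and M2: "2 \<le> real M" using M Lam by linarith+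
  have "real M * d x / (2 * \<Lambda>) \<le> real M * d x / 2"
    using Lam M0 small by (intro divide_left_mono) auto
  have xc: "dist x c = real M * d x" using e M0 small by (simp add: c_def dist_norm)
  have "dist x y \<le> dist x c + dist c y" by (rule dist_triangle)
  with xc cy \<open>real M * d x / (2 * \<Lambda>) \<le> real M * d x / 2\<close> have xy: "dist x y < 3/2 * (real M * d x)" by linarith
  have Md: "0 < real M * d x" using M0 small by simp
  then show "dist x y < 2 * real M * d x" using xy by simp
  have "real M * d x \<le> r/8" using small M0 by (simp add: field_simps)
  have "dist z y \<le> dist z x + dist x y" by (rule dist_triangle)
  then have zy: "dist z y < r/2" using x xy \<open>real M * d x \<le> r/8\<close> r by linarith
  show tx: "0 < t x" using chart[of x] x r by auto
  show "t x \<le> \<Lambda> * d x" using height_le_infdist x r by auto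
  have "\<bar>t c - t y\<bar> \<le> \<Lambda> * dist c y" by (rule lip)
  also have "\<dots> \<le> \<Lambda> * (real M * d x / (2 * \<Lambda>))" using cy Lam by (intro mult_left_mono) auto
  also have "\<dots> = real M * d x / 2" using Lam by simp
  finally have ty: "real M * d x / 2 \<le> t y" using shift[of x "real M * d x"] tx unfolding c_def by linarith
  then show "y \<in> \<Omega>" using chart[of y] zy r Md by auto
  have "real M * d x / 2 \<le> \<Lambda> * d y" using ty height_le_infdist[of y] zy by simp
  then show *: "d x \<le> 2 * \<Lambda> / real M * d y" using M0 by (simp add: field_simps)
  have "2 * \<Lambda> / real M * d y \<le> 1 * d y" using M M0 by (intro mult_right_mono) (auto simp: infdist_nonneg)
  with * show "d x \<le> d y" by simp
  have "d y \<le> d x + dist y x" by (rule infdist_triangle)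
  moreover have "2 * d x \<le> real M * d x" using M2 small by (intro mult_right_mono) auto
  ultimately show "d y \<le> 3 * real M * d x" using xy Md by (simp add: dist_commute)
qed

lemma jump_measurable [measurable]:
  assumes [measurable]: "A \<in> sets borel"
  shows "jump M A \<in> sets (lborel \<Otimes>\<^sub>M lborel)"
proof -
  have "{w \<in> space (lborel \<Otimes>\<^sub>M lborel). fst w \<in> A \<and>
     dist (fst w + (real M * d (fst w)) *\<^sub>R e) (snd w) < real M * d (fst w) / (2 * \<Lambda>)} \<in> sets (lborel \<Otimes>\<^sub>M lborel)"
    by measurable
  then show ?thesis by (simp add: jump_def space_pair_measure)
qed

definition jump_vol :: "nat \<Rightarrow> 'a \<Rightarrow> real" where
  "jump_vol M x = unit_ball_vol (real DIM('a)) * (real M * d x / (2 * \<Lambda>)) ^ DIM('a)"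

lemma jump_vol_measurable [measurable]: "jump_vol M \<in> borel_measurable borel"
  unfolding jump_vol_def by measurable

text \<open>
The decisive gain. All starting points \<open>x\<close> of jumps to \<open>y\<close> have \<open>d x\<close> comparable with \<open>d y / M\<close>; the weight thus
grows by a factor of order \<open>M powr a\<close>, but the starting points fill only a layer of relative volume of order
\<open>1 / M\<close>.
\<close>

lemma jump_kernel_column:
  assumes A [measurable]: "A \<in> sets borel" and sub: "A \<subseteq> \<Omega> \<inter> ball z (r/4)" and M: "2 * \<Lambda> \<le> real M"
    and small: "\<And>x. x \<in> A \<Longrightarrow> \<eta> < d x \<and> d x \<le> r / (8 * real M)" and \<eta>: "0 < \<eta>" and a: "0 < a"
  shows "(\<integral>\<^sup>+x. ennreal (d x powr (- a) / jump_vol M x) * indicator (jump M A) (x, y) \<partial>lborel)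
     \<le> ennreal (3 powr a * (42 * \<Lambda> ^ 3) ^ DIM('a) * real M powr (a - 1) * d y powr (- a))
         * indicator {y \<in> \<Omega>. \<eta> < d y} y"
proof (cases "\<exists>x. (x, y) \<in> jump M A")
  case False
  then show ?thesis by (simp add: indicator_def)
next
  case True
  define L where "L = {x. (x, y) \<in> jump M A}"
  let ?n = "DIM('a)"
  define D where "D = d y"
  define \<omega> where "\<omega> = unit_ball_vol (real ?n)"
  have \<omega>: "0 < \<omega>" by (simp add: \<omega>_def)
  have M0: "0 < real M" using M Lam by linarith
  have inA: "x \<in> A" if "x \<in> L" for x using that by (auto simp: L_def jump_def)
  have small': "0 < d x" "d x \<le> r / (8 * real M)" if "x \<in> L" for x
    using small[OF inA[OF that]] \<eta> by auto
  have L: "dist x y < 2 * real M * d x" "y \<in> \<Omega>" "d x \<le> 2 * \<Lambda> / real M * D" "d x \<le> D"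
    "D \<le> 3 * real M * d x" "0 < t x" "t x \<le> \<Lambda> * d x" if "x \<in> L" for x
    using jump_geometry[OF _ sub M small'[OF that]] that by (auto simp: L_def D_def)
  obtain x0 where x0: "x0 \<in> L" using True by (auto simp: L_def)
  have D: "\<eta> < D" using L(4)[OF x0] small[OF inA[OF x0]] by linarith
  then have D0: "0 < D" using \<eta> by simp
  have yin: "y \<in> {y \<in> \<Omega>. \<eta> < d y}" using L(2)[OF x0] D by (simp add: D_def)
  have Lm [measurable]: "L \<in> sets borel"
  proof -
    have "{x \<in> space lborel. (x, y) \<in> jump M A} \<in> sets lborel" by measurable
    then show ?thesis by (simp add: L_def)
  qed
  \<comment> \<open>On \<open>L\<close> the height is at most \<open>\<tau>\<close>, and \<open>M\<close> steps of length \<open>\<tau>\<close> make a distance comparable with \<open>D\<close>.\<close>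
  define \<tau> where "\<tau> = \<Lambda> * (2 * \<Lambda> / real M * D)"
  have \<tau>: "0 \<le> \<tau>" using D0 Lam by (simp add: \<tau>_def)
  have "of_nat M * emeasure lborel L \<le> emeasure lborel (ball y (5 * \<Lambda> * D + real M * \<tau>))"
  proof (rule thin_layer_emeasure[OF Lm shift e _ _ \<tau>])
    show "0 < t x \<and> t x \<le> \<tau>" if "x \<in> L" for x
    proof -
      have "\<Lambda> * d x \<le> \<tau>" unfolding \<tau>_def using L(3)[OF that] Lam by (intro mult_left_mono) auto
      then show ?thesis using L(6,7)[OF that] by simp
    qed
    show "L \<subseteq> ball y (5 * \<Lambda> * D)"
    proof
      fix x assume x: "x \<in> L"
      have "real M * d x \<le> real M * (2 * \<Lambda> / real M * D)" using L(3)[OF x] M0 by (intro mult_left_mono) auto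
      also have "\<dots> = 2 * \<Lambda> * D" using M0 by simp
      finally have "real M * d x \<le> 2 * \<Lambda> * D" .
      moreover have "0 < \<Lambda> * D" using D0 Lam by simp
      ultimately have "dist x y < 5 * \<Lambda> * D" using L(1)[OF x] by linarith
      then show "x \<in> ball y (5 * \<Lambda> * D)" by (simp add: dist_commute)
    qed
  qed
  also have "\<dots> \<le> emeasure lborel (ball y (7 * \<Lambda>\<^sup>2 * D))"
  proof (intro emeasure_mono subset_ball)
    have "\<Lambda> * D \<le> \<Lambda>\<^sup>2 * D" using Lam D0 by (simp add: power2_eq_square)
    moreover have "real M * \<tau> = 2 * (\<Lambda>\<^sup>2 * D)" using M0 by (simp add: \<tau>_def power2_eq_square)
    ultimately show "5 * \<Lambda> * D + real M * \<tau> \<le> 7 * \<Lambda>\<^sup>2 * D" by linarith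
  qed simp
  also have "\<dots> = ennreal (\<omega> * (7 * \<Lambda>\<^sup>2 * D) ^ ?n)"
    using D0 by (simp add: emeasure_ball \<omega>_def)
  finally have "ennreal (1 / real M) * (of_nat M * emeasure lborel L)
      \<le> ennreal (1 / real M) * ennreal (\<omega> * (7 * \<Lambda>\<^sup>2 * D) ^ ?n)"
    by (rule mult_left_mono) simp
  moreover have "ennreal (1 / real M) * (of_nat M * emeasure lborel L) = emeasure lborel L"
    using M0 by (simp add: ennreal_of_nat_eq_real_of_nat mult.assoc[symmetric] flip: ennreal_mult')
  ultimately have eL: "emeasure lborel L \<le> ennreal (\<omega> * (7 * \<Lambda>\<^sup>2 * D) ^ ?n / real M)"
    using M0 by (simp flip: ennreal_mult')
  \<comment> \<open>\<open>B\<close> bounds the integrand on \<open>L\<close>, because there \<open>d x\<close> is at least \<open>D / (3 * M)\<close>.\<close>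
  define B where "B = (D / (3 * real M)) powr (- a) / (\<omega> * (D / (6 * \<Lambda>)) ^ ?n)"
  have cancel: "x / (\<omega> * w ^ ?n) * (\<omega> * v ^ ?n / m) = x / m * (v / w) ^ ?n" for x w v m :: real
    using \<omega> by (simp add: power_divide)
  have B0: "0 \<le> B" using \<omega> D0 Lam by (simp add: B_def)
  have "(\<integral>\<^sup>+x. ennreal (d x powr (- a) / jump_vol M x) * indicator (jump M A) (x, y) \<partial>lborel)
      \<le> (\<integral>\<^sup>+x. ennreal B * indicator L x \<partial>lborel)"
  proof (rule nn_integral_mono)
    fix x
    show "ennreal (d x powr (- a) / jump_vol M x) * indicator (jump M A) (x, y) \<le> ennreal B * indicator L x"
    proof (cases "x \<in> L")
      case True
      have lo: "D / (3 * real M) \<le> d x" using L(5)[OF True] M0 by (simp add: field_simps)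
      have lo': "D / (6 * \<Lambda>) \<le> real M * d x / (2 * \<Lambda>)"
        using L(5)[OF True] Lam by (simp add: field_simps)
      have "d x powr (- a) / jump_vol M x \<le> B"
        unfolding B_def jump_vol_def \<omega>_def[symmetric]
      proof (rule frac_le)
        show "d x powr - a \<le> (D / (3 * real M)) powr - a"
          using lo D0 M0 a by (intro powr_mono2') auto
        show "\<omega> * (D / (6 * \<Lambda>)) ^ ?n \<le> \<omega> * (real M * d x / (2 * \<Lambda>)) ^ ?n"
          using lo' D0 Lam \<omega> by (intro mult_left_mono power_mono) auto
        show "0 < \<omega> * (D / (6 * \<Lambda>)) ^ ?n" using \<omega> D0 Lam by simp
      qed simp
      then show ?thesis using True by (simp add: L_def ennreal_leI)
    qed (simp add: L_def)
  qed
  also have "\<dots> = ennreal B * emeasure lborel L"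
    by (simp add: nn_integral_cmult_indicator)
  also have "\<dots> \<le> ennreal B * ennreal (\<omega> * (7 * \<Lambda>\<^sup>2 * D) ^ ?n / real M)"
    by (intro mult_left_mono eL) simp
  also have "\<dots> = ennreal (B * (\<omega> * (7 * \<Lambda>\<^sup>2 * D) ^ ?n / real M))"
    using B0 by (rule ennreal_mult'[symmetric])
  also have "B * (\<omega> * (7 * \<Lambda>\<^sup>2 * D) ^ ?n / real M)
      = (D / (3 * real M)) powr (- a) / real M * ((7 * \<Lambda>\<^sup>2 * D) / (D / (6 * \<Lambda>))) ^ ?n"
    unfolding B_def by (rule cancel)
  also have "(7 * \<Lambda>\<^sup>2 * D) / (D / (6 * \<Lambda>)) = 42 * \<Lambda> ^ 3"
    using D0 Lam by (simp add: field_simps power2_eq_square power3_eq_cube)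
  also have "(D / (3 * real M)) powr (- a) / real M = 3 powr a * real M powr (a - 1) * D powr (- a)"
    using D0 M0 by (simp add: powr_divide powr_mult powr_minus powr_diff field_simps)
  finally show ?thesis
    using yin by (simp add: D_def[symmetric] mult_ac)
qed

end

lemma abs_powr_triangle_le:
  fixes x y :: real
  assumes "0 \<le> q"
  shows "\<bar>x\<bar> powr q \<le> 2 powr q * (\<bar>y\<bar> powr q + \<bar>x - y\<bar> powr q)"
proof -
  have "\<bar>x\<bar> powr q \<le> (2 * max \<bar>y\<bar> \<bar>x - y\<bar>) powr q"
  proof (rule powr_mono2)
    show "\<bar>x\<bar> \<le> 2 * max \<bar>y\<bar> \<bar>x - y\<bar>" proof -
      have "\<bar>x\<bar> \<le> \<bar>y\<bar> + \<bar>x - y\<bar>" by linarith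
      moreover have "\<bar>y\<bar> \<le> max \<bar>y\<bar> \<bar>x - y\<bar>" "\<bar>x - y\<bar> \<le> max \<bar>y\<bar> \<bar>x - y\<bar>" by simp_all
      ultimately show ?thesis by linarith
    qed
  qed (use assms in auto)
  also have "\<dots> = 2 powr q * max \<bar>y\<bar> \<bar>x - y\<bar> powr q" by (simp add: powr_mult)
  also have "max \<bar>y\<bar> \<bar>x - y\<bar> powr q \<le> \<bar>y\<bar> powr q + \<bar>x - y\<bar> powr q" by (auto simp: max_def)
  finally show ?thesis by simp
qed

text \<open>
The Hardy integral over the part of \<open>S\<close> that lies at depth more than \<open>\<eta>\<close>. The truncation makes it finite for
\<open>q\<close>-integrable \<open>u\<close>, and targets of jumps are at least as deep as their starting points, so jumps respect it.
\<close>

definition truncated_hardy ::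
    "real \<Rightarrow> real \<Rightarrow> 'a::euclidean_space set \<Rightarrow> ('a \<Rightarrow> real) \<Rightarrow> real \<Rightarrow> 'a set \<Rightarrow> ennreal" where
  "truncated_hardy a q \<Omega> u \<eta> S =
     (\<integral>\<^sup>+x\<in>{x \<in> \<Omega> \<inter> S. \<eta> < infdist x (- \<Omega>)}.
        ennreal (\<bar>u x\<bar> powr q * infdist x (- \<Omega>) powr (- a)) \<partial>lborel)"

text \<open>
With \<open>a = r * q\<close> this is the \<open>q\<close>-th power of the Gagliardo seminorm of order \<open>r\<close>.
\<close>

definition seminorm_powr :: "real \<Rightarrow> real \<Rightarrow> 'a::euclidean_space set \<Rightarrow> ('a \<Rightarrow> real) \<Rightarrow> ennreal" where
  "seminorm_powr a q \<Omega> u =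
     (\<integral>\<^sup>+x\<in>\<Omega>. (\<integral>\<^sup>+y\<in>\<Omega>. ennreal (\<bar>u x - u y\<bar> powr q / norm (x - y) powr (real DIM('a) + a)) \<partial>lborel) \<partial>lborel)"

context boundary_chart
begin

text \<open>
Average the inequality \<open>\<bar>u x\<bar> powr q \<le> 2 powr q * (\<bar>u y\<bar> powr q + \<bar>u x - u y\<bar> powr q)\<close> over the targets \<open>y\<close> of
\<open>x\<close>, multiply by the weight, and integrate over \<open>x \<in> A\<close>. Targets are at distance less than \<open>2 * M * d x\<close>, so
the differences are controlled by the Gagliardo kernel at the cost of a constant that depends on \<open>M\<close>, while
the factor in front of the Hardy integral decays like \<open>M powr (a - 1)\<close>.
\<close>

lemma jump_averaging:
  assumes u [measurable]: "u \<in> borel_measurable borel" and \<Omega> [measurable]: "\<Omega> \<in> sets borel"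
    and A [measurable]: "A \<in> sets borel" and sub: "A \<subseteq> \<Omega> \<inter> ball z (r/4)" and M: "2 * \<Lambda> \<le> real M"
    and small: "\<And>x. x \<in> A \<Longrightarrow> \<eta> < d x \<and> d x \<le> r / (8 * real M)" and \<eta>: "0 < \<eta>"
    and a: "0 < a" and q: "0 < q"
  shows "(\<integral>\<^sup>+x\<in>A. ennreal (\<bar>u x\<bar> powr q * d x powr (- a)) \<partial>lborel)
    \<le> ennreal (2 powr q * (3 powr a * (42 * \<Lambda> ^ 3) ^ DIM('a) * real M powr (a - 1))) * truncated_hardy a q \<Omega> u \<eta> UNIV
      + ennreal (2 powr q * ((2 * real M) powr (real DIM('a) + a)
          / (unit_ball_vol (real DIM('a)) * (real M / (2 * \<Lambda>)) ^ DIM('a)))) * seminorm_powr a q \<Omega> u"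
proof -
  let ?n = "DIM('a)"
  define K where "K = 3 powr a * (42 * \<Lambda> ^ 3) ^ ?n * real M powr (a - 1)"
  define \<omega> where "\<omega> = unit_ball_vol (real ?n)"
  define B where "B = (2 * real M) powr (real ?n + a) / (\<omega> * (real M / (2 * \<Lambda>)) ^ ?n)"
  define k where "k x = d x powr (- a) / jump_vol M x" for x
  define J where "J = jump M A"
  define G where "G x y = \<bar>u x - u y\<bar> powr q / norm (x - y) powr (real ?n + a)" for x y
  have J [measurable]: "J \<in> sets (lborel \<Otimes>\<^sub>M lborel)" unfolding J_def by measurable
  have k [measurable]: "k \<in> borel_measurable borel" unfolding k_def by measurable
  have G [measurable]: "(\<lambda>(x, y). G x y) \<in> borel_measurable (lborel \<Otimes>\<^sub>M lborel)"
    unfolding G_def by measurable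
  have \<omega>: "0 < \<omega>" by (simp add: \<omega>_def)
  have M0: "0 < real M" using M Lam by linarith
  have B0: "0 \<le> B" using \<omega> Lam by (simp add: B_def)
  have K0: "0 \<le> K" using Lam by (simp add: K_def)
  have vol0: "0 \<le> jump_vol M x" for x
    using Lam by (simp add: jump_vol_def infdist_nonneg)
  then have k0: "0 \<le> k x" for x by (simp add: k_def)
  have pointwise: "ennreal (\<bar>u x\<bar> powr q * k x) * indicator J (x, y)
      \<le> ennreal (2 powr q) * (ennreal (\<bar>u y\<bar> powr q) * (ennreal (k x) * indicator J (x, y)))
        + ennreal (2 powr q * B) * (ennreal (G x y) * indicator \<Omega> y)" for x y
  proof (cases "(x, y) \<in> J")
    case True
    then have x: "x \<in> A" by (simp add: J_def jump_def)
    then have dx: "0 < d x" "d x \<le> r / (8 * real M)" using small \<eta> by force+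
    note geom = jump_geometry[OF True[unfolded J_def] sub M dx]
    have G_ge: "\<bar>u x - u y\<bar> powr q * k x \<le> B * G x y"
    proof (cases "x = y")
      case False
      have N: "0 < norm (x - y)" "norm (x - y) \<le> 2 * real M * d x"
        using geom(1) False by (auto simp: dist_norm)
      have "norm (x - y) powr (real ?n + a) \<le> (2 * real M * d x) powr (real ?n + a)"
        using N a by (intro powr_mono2) auto
      moreover have "(2 * real M * d x) powr (real ?n + a) * k x = B"
      proof -
        have "(2 * real M * d x) powr (real ?n + a) * d x powr (- a)
            = (2 * real M) powr (real ?n + a) * d x ^ ?n"
          using dx M0 by (simp add: powr_mult powr_add[symmetric] powr_realpow mult.assoc)
        moreover have "jump_vol M x = \<omega> * (real M / (2 * \<Lambda>)) ^ ?n * d x ^ ?n"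
          by (simp add: jump_vol_def \<omega>_def power_mult_distrib power_divide)
        ultimately show ?thesis using dx unfolding k_def B_def by simp
      qed
      ultimately have "norm (x - y) powr (real ?n + a) * k x \<le> B"
        using k0[of x] by (metis mult_right_mono)
      then have "G x y * (norm (x - y) powr (real ?n + a) * k x) \<le> G x y * B"
        by (intro mult_left_mono) (auto simp: G_def)
      moreover have "G x y * (norm (x - y) powr (real ?n + a) * k x) = \<bar>u x - u y\<bar> powr q * k x"
      proof -
        have "\<bar>u x - u y\<bar> powr q = G x y * norm (x - y) powr (real ?n + a)"
          using N by (simp add: G_def)
        then show ?thesis by (metis mult.assoc)
      qed
      ultimately show ?thesis by (metis mult.commute)
    qed (simp add: G_def)
    have "\<bar>u x\<bar> powr q * k x \<le> 2 powr q * (\<bar>u y\<bar> powr q + \<bar>u x - u y\<bar> powr q) * k x"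
      using q k0 by (intro mult_right_mono abs_powr_triangle_le) auto
    also have "\<dots> = 2 powr q * (\<bar>u y\<bar> powr q * k x) + 2 powr q * (\<bar>u x - u y\<bar> powr q * k x)"
      by (simp add: algebra_simps)
    also have "\<dots> \<le> 2 powr q * (\<bar>u y\<bar> powr q * k x) + 2 powr q * (B * G x y)"
      using G_ge by simp
    finally have "ennreal (\<bar>u x\<bar> powr q * k x)
        \<le> ennreal (2 powr q * (\<bar>u y\<bar> powr q * k x) + 2 powr q * B * G x y)"
      by (simp add: ennreal_leI mult.assoc)
    also have "\<dots> = ennreal (2 powr q * (\<bar>u y\<bar> powr q * k x)) + ennreal (2 powr q * B * G x y)"
      using k0 B0 by (intro ennreal_plus) (auto simp: G_def)
    also have "\<dots> = ennreal (2 powr q) * (ennreal (\<bar>u y\<bar> powr q) * ennreal (k x))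
        + ennreal (2 powr q * B) * ennreal (G x y)"
      using B0 by (simp add: ennreal_mult')
    finally show ?thesis using True geom(2) by simp
  qed simp
  \<comment> \<open>The ball of targets of \<open>x\<close> has volume \<open>jump_vol M x\<close>, which cancels the denominator of \<open>k x\<close>.\<close>
  have column: "ennreal (\<bar>u x\<bar> powr q * d x powr (- a)) * indicator A x
      \<le> ennreal (2 powr q) * (\<integral>\<^sup>+y. ennreal (\<bar>u y\<bar> powr q) * (ennreal (k x) * indicator J (x, y)) \<partial>lborel)
        + ennreal (2 powr q * B) * ((\<integral>\<^sup>+y\<in>\<Omega>. ennreal (G x y) \<partial>lborel) * indicator \<Omega> x)" for x
  proof (cases "x \<in> A")
    case True
    then have dx: "0 < d x" using small \<eta> by force
    have ball: "{y. (x, y) \<in> J} = ball (x + (real M * d x) *\<^sub>R e) (real M * d x / (2 * \<Lambda>))"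
      using True by (auto simp: J_def jump_def)
    have "emeasure lborel {y. (x, y) \<in> J} = ennreal (jump_vol M x)"
      unfolding ball jump_vol_def using Lam dx by (intro emeasure_ball) simp
    moreover have "\<bar>u x\<bar> powr q * d x powr (- a) = (\<bar>u x\<bar> powr q * k x) * jump_vol M x"
    proof -
      have "jump_vol M x \<noteq> 0" using dx M0 Lam \<omega> by (simp add: jump_vol_def \<omega>_def[symmetric])
      then show ?thesis by (simp add: k_def)
    qed
    ultimately have "ennreal (\<bar>u x\<bar> powr q * d x powr (- a))
        = ennreal (\<bar>u x\<bar> powr q * k x) * emeasure lborel {y. (x, y) \<in> J}"
      using vol0 by (simp only: ennreal_mult'')
    also have "\<dots> = (\<integral>\<^sup>+y. ennreal (\<bar>u x\<bar> powr q * k x) * indicator J (x, y) \<partial>lborel)"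
    proof -
      have "(\<integral>\<^sup>+y. ennreal (\<bar>u x\<bar> powr q * k x) * indicator {y. (x, y) \<in> J} y \<partial>lborel)
          = ennreal (\<bar>u x\<bar> powr q * k x) * emeasure lborel {y. (x, y) \<in> J}"
        by (rule nn_integral_cmult_indicator) (simp add: ball)
      then show ?thesis by (simp add: indicator_def)
    qed
    also have "\<dots> \<le> (\<integral>\<^sup>+y. ennreal (2 powr q) * (ennreal (\<bar>u y\<bar> powr q) * (ennreal (k x) * indicator J (x, y)))
        + ennreal (2 powr q * B) * (ennreal (G x y) * indicator \<Omega> y) \<partial>lborel)"
      by (intro nn_integral_mono pointwise)
    also have "\<dots> = ennreal (2 powr q) * (\<integral>\<^sup>+y. ennreal (\<bar>u y\<bar> powr q) * (ennreal (k x) * indicator J (x, y)) \<partial>lborel)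
        + ennreal (2 powr q * B) * (\<integral>\<^sup>+y\<in>\<Omega>. ennreal (G x y) \<partial>lborel)"
      by (subst nn_integral_add) (auto simp: nn_integral_cmult)
    finally show ?thesis using True sub by auto
  qed simp
  have "(\<integral>\<^sup>+x\<in>A. ennreal (\<bar>u x\<bar> powr q * d x powr (- a)) \<partial>lborel)
     \<le> (\<integral>\<^sup>+x. ennreal (2 powr q) * (\<integral>\<^sup>+y. ennreal (\<bar>u y\<bar> powr q) * (ennreal (k x) * indicator J (x, y)) \<partial>lborel)
        + ennreal (2 powr q * B) * ((\<integral>\<^sup>+y\<in>\<Omega>. ennreal (G x y) \<partial>lborel) * indicator \<Omega> x) \<partial>lborel)"
    by (intro nn_integral_mono column)
  also have "\<dots> = ennreal (2 powr q) * (\<integral>\<^sup>+x. \<integral>\<^sup>+y. ennreal (\<bar>u y\<bar> powr q) * (ennreal (k x) * indicator J (x, y)) \<partial>lborel \<partial>lborel)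
        + ennreal (2 powr q * B) * seminorm_powr a q \<Omega> u"
    unfolding seminorm_powr_def G_def[symmetric]
    by (subst nn_integral_add) (auto simp: nn_integral_cmult)
  finally have le: "(\<integral>\<^sup>+x\<in>A. ennreal (\<bar>u x\<bar> powr q * d x powr (- a)) \<partial>lborel)
     \<le> ennreal (2 powr q) * (\<integral>\<^sup>+x. \<integral>\<^sup>+y. ennreal (\<bar>u y\<bar> powr q) * (ennreal (k x) * indicator J (x, y)) \<partial>lborel \<partial>lborel)
        + ennreal (2 powr q * B) * seminorm_powr a q \<Omega> u" .
  \<comment> \<open>Integrating first over the starting points \<open>x\<close> produces the small factor \<open>K\<close>.\<close>
  have "(\<integral>\<^sup>+x. \<integral>\<^sup>+y. ennreal (\<bar>u y\<bar> powr q) * (ennreal (k x) * indicator J (x, y)) \<partial>lborel \<partial>lborel)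
     = (\<integral>\<^sup>+y. \<integral>\<^sup>+x. ennreal (\<bar>u y\<bar> powr q) * (ennreal (k x) * indicator J (x, y)) \<partial>lborel \<partial>lborel)"
    by (rule lborel_pair.Fubini'[symmetric]) measurable
  also have "\<dots> \<le> (\<integral>\<^sup>+y. ennreal K * (ennreal (\<bar>u y\<bar> powr q * d y powr (- a)) * indicator {y \<in> \<Omega> \<inter> UNIV. \<eta> < d y} y) \<partial>lborel)"
  proof (rule nn_integral_mono)
    fix y
    have "(\<integral>\<^sup>+x. ennreal (\<bar>u y\<bar> powr q) * (ennreal (k x) * indicator J (x, y)) \<partial>lborel)
       = ennreal (\<bar>u y\<bar> powr q) * (\<integral>\<^sup>+x. ennreal (k x) * indicator J (x, y) \<partial>lborel)"
      by (rule nn_integral_cmult) measurable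
    also have "\<dots> \<le> ennreal (\<bar>u y\<bar> powr q) * (ennreal (K * d y powr (- a)) * indicator {y \<in> \<Omega>. \<eta> < d y} y)"
      using jump_kernel_column[OF A sub M small \<eta> a, of y]
      by (intro mult_left_mono) (auto simp: k_def J_def K_def)
    finally show "(\<integral>\<^sup>+x. ennreal (\<bar>u y\<bar> powr q) * (ennreal (k x) * indicator J (x, y)) \<partial>lborel)
       \<le> ennreal K * (ennreal (\<bar>u y\<bar> powr q * d y powr (- a)) * indicator {y \<in> \<Omega> \<inter> UNIV. \<eta> < d y} y)"
      using K0 by (simp add: ennreal_mult' mult_ac)
  qed
  also have "\<dots> = ennreal K * truncated_hardy a q \<Omega> u \<eta> UNIV"
    unfolding truncated_hardy_def by (rule nn_integral_cmult) measurable
  finally have swap: "(\<integral>\<^sup>+x. \<integral>\<^sup>+y. ennreal (\<bar>u y\<bar> powr q) * (ennreal (k x) * indicator J (x, y)) \<partial>lborel \<partial>lborel)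
      \<le> ennreal K * truncated_hardy a q \<Omega> u \<eta> UNIV" .
  have K: "ennreal (2 powr q * K) * truncated_hardy a q \<Omega> u \<eta> UNIV
      = ennreal (2 powr q) * (ennreal K * truncated_hardy a q \<Omega> u \<eta> UNIV)"
    using K0 by (simp only: ennreal_mult' powr_ge_zero mult.assoc)
  show ?thesis
    unfolding K_def[symmetric] B_def[symmetric] \<omega>_def[symmetric] K
    by (rule order_trans[OF le add_right_mono[OF mult_left_mono[OF swap]]]) simp
qed

end

section \<open>The fractional Hardy inequality\<close>

lemma truncated_hardy_Un_le:
  assumes [measurable]: "u \<in> borel_measurable borel" "\<Omega> \<in> sets borel" "S \<in> sets borel" "T \<in> sets borel"
  shows "truncated_hardy a q \<Omega> u \<eta> (S \<union> T) \<le> truncated_hardy a q \<Omega> u \<eta> S + truncated_hardy a q \<Omega> u \<eta> T"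
  unfolding truncated_hardy_def
  by (subst nn_integral_add[symmetric]) (auto intro!: nn_integral_mono simp: indicator_def)

lemma nn_integral_hardy_away_le:
  fixes u :: "'a::euclidean_space \<Rightarrow> real"
  assumes [measurable]: "u \<in> borel_measurable borel" "\<Omega> \<in> sets borel" and "0 < \<delta>" "0 \<le> a"
    and S: "\<And>x. x \<in> S \<Longrightarrow> x \<in> \<Omega> \<and> \<delta> \<le> infdist x (- \<Omega>)"
  shows "(\<integral>\<^sup>+x\<in>S. ennreal (\<bar>u x\<bar> powr q * infdist x (- \<Omega>) powr (- a)) \<partial>lborel)
     \<le> ennreal (\<delta> powr (- a)) * (\<integral>\<^sup>+x\<in>\<Omega>. ennreal (\<bar>u x\<bar> powr q) \<partial>lborel)"
proof -
  have "(\<integral>\<^sup>+x\<in>S. ennreal (\<bar>u x\<bar> powr q * infdist x (- \<Omega>) powr (- a)) \<partial>lborel)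
     \<le> (\<integral>\<^sup>+x. ennreal (\<delta> powr (- a)) * (ennreal (\<bar>u x\<bar> powr q) * indicator \<Omega> x) \<partial>lborel)"
  proof (rule nn_integral_mono)
    fix x
    show "ennreal (\<bar>u x\<bar> powr q * infdist x (- \<Omega>) powr (- a)) * indicator S x
      \<le> ennreal (\<delta> powr (- a)) * (ennreal (\<bar>u x\<bar> powr q) * indicator \<Omega> x)"
    proof (cases "x \<in> S")
      case True
      then have "infdist x (- \<Omega>) powr (- a) \<le> \<delta> powr (- a)"
        using S assms(3,4) by (intro powr_mono2') auto
      then have "\<bar>u x\<bar> powr q * infdist x (- \<Omega>) powr (- a) \<le> \<delta> powr (- a) * \<bar>u x\<bar> powr q"
        by (subst mult.commute) (intro mult_right_mono, auto)
      then show ?thesis using True S by (simp add: ennreal_leI flip: ennreal_mult')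
    qed simp
  qed
  also have "\<dots> = ennreal (\<delta> powr (- a)) * (\<integral>\<^sup>+x\<in>\<Omega>. ennreal (\<bar>u x\<bar> powr q) \<partial>lborel)"
    by (rule nn_integral_cmult) measurable
  finally show ?thesis .
qed

text \<open>
The ball must not depend on \<open>\<theta>\<close>: the number of balls needed to cover \<open>\<Omega>\<close> has to be known before \<open>\<theta>\<close> is chosen.
A smaller \<open>\<theta>\<close> only confines the jumps to points closer to the boundary; the others contribute to \<open>C\<close>.
\<close>

lemma truncated_hardy_local:
  fixes \<Omega> :: "'a::euclidean_space set" and u :: "'a \<Rightarrow> real"
  assumes \<Omega>: "open \<Omega>" "lipschitz_boundary \<Omega>" and z: "z \<in> closure \<Omega>"
    and u [measurable]: "u \<in> borel_measurable borel" and a: "0 < a" "a < 1" and q: "0 < q"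
    and Lq: "(\<integral>\<^sup>+x\<in>\<Omega>. ennreal (\<bar>u x\<bar> powr q) \<partial>lborel) < \<infinity>"
    and semi: "seminorm_powr a q \<Omega> u < \<infinity>"
    and ne: "- \<Omega> \<noteq> {}"
  shows "\<exists>\<rho>>0. \<forall>\<theta>>0. \<exists>C<\<infinity>. \<forall>\<eta>>0. truncated_hardy a q \<Omega> u \<eta> (ball z \<rho>)
    \<le> C + ennreal \<theta> * truncated_hardy a q \<Omega> u \<eta> UNIV"
proof (cases "z \<in> \<Omega>")
  case True
  then obtain \<rho> where \<rho>: "0 < \<rho>" "ball z \<rho> \<subseteq> \<Omega>" using \<Omega>(1) openE by blast
  have m: "\<Omega> \<in> sets borel" using \<Omega>(1) by simp
  define C where "C = ennreal ((\<rho>/2) powr (- a)) * (\<integral>\<^sup>+x\<in>\<Omega>. ennreal (\<bar>u x\<bar> powr q) \<partial>lborel)"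
  have "C < \<infinity>" unfolding C_def using Lq by (simp add: ennreal_mult_less_top)
  moreover have "truncated_hardy a q \<Omega> u \<eta> (ball z (\<rho>/2)) \<le> C" for \<eta>
    unfolding truncated_hardy_def C_def
  proof (rule nn_integral_hardy_away_le[OF u m])
    fix x assume x: "x \<in> {x \<in> \<Omega> \<inter> ball z (\<rho>/2). \<eta> < infdist x (- \<Omega>)}"
    have "\<rho>/2 \<le> infdist x (- \<Omega>)"
      unfolding infdist_notempty[OF ne]
    proof (rule cINF_greatest[OF ne])
      fix w assume "w \<in> - \<Omega>"
      then have "\<rho> \<le> dist z w" using \<rho> by (meson ComplD mem_ball not_le subsetD)
      moreover have "dist z w \<le> dist z x + dist x w" by (rule dist_triangle)
      ultimately show "\<rho>/2 \<le> dist x w" using x by simp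
    qed
    then show "x \<in> \<Omega> \<and> \<rho>/2 \<le> infdist x (- \<Omega>)" using x by simp
  qed (use \<rho> a in auto)
  ultimately show ?thesis
    using \<rho>(1) by (intro exI[of _ "\<rho>/2"]) (auto intro!: exI[of _ C] intro: order_trans add_increasing2)
next
  case False
  then have zf: "z \<in> frontier \<Omega>" using z \<Omega>(1) by (simp add: frontier_def interior_open)
  obtain r \<Lambda> e t where "boundary_chart \<Omega> z e r \<Lambda> t"
  proof (rule lipschitz_boundary_chart[OF \<Omega>(2) zf])
    fix r \<Lambda> e t
    assume "0 < r" "1 \<le> \<Lambda>" "norm e = 1" "\<And>x y. \<bar>t x - t y\<bar> \<le> \<Lambda> * dist x y"
      "\<And>x \<tau>. t (x + \<tau> *\<^sub>R e) = t x + \<tau>" "\<And>y. y \<in> ball z r \<Longrightarrow> (y \<in> \<Omega>) = (0 < t y)"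
    then show thesis using that[of e r \<Lambda> t] False by (simp add: boundary_chart_def)
  qed
  then interpret boundary_chart \<Omega> z e r \<Lambda> t .
  have [measurable]: "\<Omega> \<in> sets borel" using \<Omega>(1) by simp
  show ?thesis
  proof (intro exI[of _ "r/4"] conjI allI impI)
    show "0 < r/4" using r by simp
    fix \<theta> :: real assume \<theta>: "0 < \<theta>"
    define c where "c = 2 powr q * (3 powr a * (42 * \<Lambda> ^ 3) ^ DIM('a))"
    have c0: "0 \<le> c" using Lam by (simp add: c_def)
    \<comment> \<open>Since \<open>a < 1\<close>, long jumps make the factor in front of the Hardy integral as small as desired.\<close>
    have "(\<lambda>M. c * real M powr (a - 1)) \<longlonglongrightarrow> c * 0"
      using a by (intro tendsto_mult_left tendsto_neg_powr filterlim_real_sequentially) auto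
    then have "eventually (\<lambda>M. c * real M powr (a - 1) < \<theta>) sequentially"
      using \<theta> by (auto dest: order_tendstoD)
    moreover have "eventually (\<lambda>M. 2 * \<Lambda> \<le> real M) sequentially"
      using filterlim_real_sequentially by (simp add: filterlim_at_top)
    ultimately obtain M where M: "c * real M powr (a - 1) < \<theta>" "2 * \<Lambda> \<le> real M"
      by (metis (mono_tags, lifting) eventually_conj eventually_sequentially order_refl)
    have M0: "0 < real M" using M Lam by linarith
    \<comment> \<open>Points of the small ball at depth at most \<open>\<delta>\<close> jump to targets inside the chart.\<close>
    define \<delta> where "\<delta> = r / (8 * real M)"
    have \<delta>: "0 < \<delta>" using r M0 by (simp add: \<delta>_def)
    define B where "B = 2 powr q * ((2 * real M) powr (real DIM('a) + a)
          / (unit_ball_vol (real DIM('a)) * (real M / (2 * \<Lambda>)) ^ DIM('a)))"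
    define C where "C = ennreal B * seminorm_powr a q \<Omega> u
      + ennreal (\<delta> powr (- a)) * (\<integral>\<^sup>+x\<in>\<Omega>. ennreal (\<bar>u x\<bar> powr q) \<partial>lborel)"
    have "C < \<infinity>" unfolding C_def using Lq semi by (simp add: ennreal_mult_less_top)
    moreover have "truncated_hardy a q \<Omega> u \<eta> (ball z (r/4)) \<le> C + ennreal \<theta> * truncated_hardy a q \<Omega> u \<eta> UNIV"
      if \<eta>: "0 < \<eta>" for \<eta>
    proof -
      define A where "A = {x \<in> \<Omega> \<inter> ball z (r/4). \<eta> < d x \<and> d x \<le> \<delta>}"
      have A [measurable]: "A \<in> sets borel"
      proof -
        have [measurable]: "ball z (r/4) \<in> sets borel" by simp
        have "{x \<in> space borel. x \<in> \<Omega> \<inter> ball z (r/4) \<and> \<eta> < d x \<and> d x \<le> \<delta>} \<in> sets borel" by measurable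
        then show ?thesis by (simp add: A_def)
      qed
      define F where "F x = ennreal (\<bar>u x\<bar> powr q * d x powr (- a))" for x
      have F [measurable]: "F \<in> borel_measurable borel" unfolding F_def by measurable
      have "truncated_hardy a q \<Omega> u \<eta> (ball z (r/4)) \<le> (\<integral>\<^sup>+x. F x * indicator A x + F x * indicator {x \<in> \<Omega>. \<delta> \<le> d x} x \<partial>lborel)"
        unfolding truncated_hardy_def F_def[symmetric]
        by (intro nn_integral_mono) (auto simp: A_def indicator_def)
      also have "\<dots> = (\<integral>\<^sup>+x\<in>A. F x \<partial>lborel) + (\<integral>\<^sup>+x\<in>{x \<in> \<Omega>. \<delta> \<le> d x}. F x \<partial>lborel)"
        by (rule nn_integral_add) measurable
      also have "(\<integral>\<^sup>+x\<in>A. F x \<partial>lborel) \<le> ennreal (c * real M powr (a - 1)) * truncated_hardy a q \<Omega> u \<eta> UNIV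
          + ennreal B * seminorm_powr a q \<Omega> u"
        unfolding F_def c_def B_def mult.assoc
        by (rule jump_averaging[OF u _ A _ M(2) _ \<eta> a(1) q, unfolded mult.assoc])
          (auto simp: A_def \<delta>_def)
      also have "(\<integral>\<^sup>+x\<in>{x \<in> \<Omega>. \<delta> \<le> d x}. F x \<partial>lborel)
          \<le> ennreal (\<delta> powr (- a)) * (\<integral>\<^sup>+x\<in>\<Omega>. ennreal (\<bar>u x\<bar> powr q) \<partial>lborel)"
        unfolding F_def using a by (intro nn_integral_hardy_away_le \<delta>) auto
      also have "ennreal (c * real M powr (a - 1)) * truncated_hardy a q \<Omega> u \<eta> UNIV
          \<le> ennreal \<theta> * truncated_hardy a q \<Omega> u \<eta> UNIV"
        using M by (intro mult_right_mono ennreal_leI) auto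
      finally show ?thesis
        unfolding C_def by (simp add: add_mono ac_simps)
    qed
    ultimately show "\<exists>C<\<infinity>. \<forall>\<eta>>0. truncated_hardy a q \<Omega> u \<eta> (ball z (r/4))
        \<le> C + ennreal \<theta> * truncated_hardy a q \<Omega> u \<eta> UNIV" by blast
  qed
qed

text \<open>
Cover the compact closure by finitely many of the local balls, choose the sum of the factors \<open>\<theta>\<close> to be \<open>1 / 2\<close>, and
absorb; the bound for the truncated integrals does not depend on \<open>\<eta>\<close>.
\<close>

lemma fractional_hardy:
  fixes \<Omega> :: "'a::euclidean_space set" and u :: "'a \<Rightarrow> real"
  assumes \<Omega>: "bounded \<Omega>" "open \<Omega>" "lipschitz_boundary \<Omega>"
    and u [measurable]: "u \<in> borel_measurable borel" and a: "0 < a" "a < 1" and q: "0 < q"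
    and Lq: "(\<integral>\<^sup>+x\<in>\<Omega>. ennreal (\<bar>u x\<bar> powr q) \<partial>lborel) < \<infinity>"
    and semi: "seminorm_powr a q \<Omega> u < \<infinity>"
  shows "(\<integral>\<^sup>+x\<in>\<Omega>. ennreal (\<bar>u x\<bar> powr q * infdist x (- \<Omega>) powr (- a)) \<partial>lborel) < \<infinity>"
proof -
  have ne: "- \<Omega> \<noteq> {}" using \<Omega>(1) not_bounded_UNIV by (metis double_complement Compl_empty_eq)
  have m [measurable]: "\<Omega> \<in> sets borel" using \<Omega>(2) by simp
  let ?T = "truncated_hardy a q \<Omega> u"
  \<comment> \<open>\<open>P\<close> passes to finite unions, because \<open>\<theta>\<close> may be halved; so compactness makes it global.\<close>
  define P where "P S \<longleftrightarrow> (\<forall>\<theta>>0. \<exists>C<\<infinity>. \<forall>\<eta>>0. ?T \<eta> S \<le> C + ennreal \<theta> * ?T \<eta> UNIV)" for S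
  have P_Un: "P (S \<union> S')" if "P S" "P S'" and m': "S \<in> sets borel" "S' \<in> sets borel" for S S'
    unfolding P_def
  proof (intro allI impI)
    fix \<theta> :: real assume "0 < \<theta>"
    then have h: "0 < \<theta>/2" by simp
    obtain C C' where C: "C < \<infinity>" "\<And>\<eta>. 0 < \<eta> \<Longrightarrow> ?T \<eta> S \<le> C + ennreal (\<theta>/2) * ?T \<eta> UNIV"
      and C': "C' < \<infinity>" "\<And>\<eta>. 0 < \<eta> \<Longrightarrow> ?T \<eta> S' \<le> C' + ennreal (\<theta>/2) * ?T \<eta> UNIV"
      using \<open>P S\<close> \<open>P S'\<close> h unfolding P_def by meson
    have "?T \<eta> (S \<union> S') \<le> (C + C') + ennreal \<theta> * ?T \<eta> UNIV" if "0 < \<eta>" for \<eta>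
    proof -
      have "?T \<eta> (S \<union> S') \<le> ?T \<eta> S + ?T \<eta> S'" by (rule truncated_hardy_Un_le[OF u m m'])
      also have "\<dots> \<le> (C + ennreal (\<theta>/2) * ?T \<eta> UNIV) + (C' + ennreal (\<theta>/2) * ?T \<eta> UNIV)"
        using C(2) C'(2) that by (intro add_mono) auto
      also have "\<dots> = (C + C') + (ennreal (\<theta>/2) + ennreal (\<theta>/2)) * ?T \<eta> UNIV"
        by (simp add: algebra_simps)
      also have "ennreal (\<theta>/2) + ennreal (\<theta>/2) = ennreal \<theta>"
        using h by (subst ennreal_plus[symmetric]) auto
      finally show ?thesis .
    qed
    then show "\<exists>C<\<infinity>. \<forall>\<eta>>0. ?T \<eta> (S \<union> S') \<le> C + ennreal \<theta> * ?T \<eta> UNIV"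
      using C(1) C'(1) by (intro exI[of _ "C + C'"]) auto
  qed
  obtain \<rho> where \<rho>: "\<And>z. z \<in> closure \<Omega> \<Longrightarrow> 0 < \<rho> z \<and> P (ball z (\<rho> z))"
    using truncated_hardy_local[OF \<Omega>(2,3) _ u a q Lq semi ne] unfolding P_def by metis
  have "compact (closure \<Omega>)" using \<Omega>(1) by simp
  then obtain D where D: "D \<subseteq> closure \<Omega>" "finite D" "closure \<Omega> \<subseteq> (\<Union>z\<in>D. ball z (\<rho> z))"
  proof (rule compactE_image[of _ "closure \<Omega>" "\<lambda>z. ball z (\<rho> z)"])
    show "closure \<Omega> \<subseteq> (\<Union>z\<in>closure \<Omega>. ball z (\<rho> z))" using \<rho> by force
  qed simp_all
  have "P (\<Union>z\<in>D. ball z (\<rho> z))"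
    using D(2,1)
  proof (induction D rule: finite_induct)
    case empty
    show ?case by (auto simp: P_def truncated_hardy_def intro!: exI[of _ 0])
  next
    case (insert z D)
    have "(\<Union>z\<in>D. ball z (\<rho> z)) \<in> sets borel" by (intro borel_open open_UN) auto
    with insert show ?case using \<rho>[of z] by (auto intro!: P_Un)
  qed
  then obtain C where C: "C < \<infinity>" "\<And>\<eta>. 0 < \<eta> \<Longrightarrow>
      ?T \<eta> (\<Union>z\<in>D. ball z (\<rho> z)) \<le> C + ennreal (1/2) * ?T \<eta> UNIV"
    unfolding P_def by (metis half_gt_zero zero_less_one)
  have bound: "?T \<eta> UNIV \<le> 2 * C" if \<eta>: "0 < \<eta>" for \<eta>
  proof -
    have "?T \<eta> UNIV \<le> ?T \<eta> (\<Union>z\<in>D. ball z (\<rho> z))"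
      unfolding truncated_hardy_def using subset_trans[OF closure_subset D(3)]
      by (intro nn_integral_mono mult_left_mono) (force simp: indicator_def dest: subsetD)+
    also have "\<dots> \<le> C + ennreal (1/2) * ?T \<eta> UNIV" by (rule C(2)[OF \<eta>])
    finally have le: "?T \<eta> UNIV \<le> C + ennreal (1/2) * ?T \<eta> UNIV" .
    \<comment> \<open>Absorbing half of the left-hand side is legitimate only because the truncated integral is finite.\<close>
    have "?T \<eta> UNIV \<le> ennreal (\<eta> powr (- a)) * (\<integral>\<^sup>+x\<in>\<Omega>. ennreal (\<bar>u x\<bar> powr q) \<partial>lborel)"
      unfolding truncated_hardy_def using a \<eta> by (intro nn_integral_hardy_away_le u m) auto
    also have "\<dots> < \<infinity>" using Lq by (simp add: ennreal_mult_less_top)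
    finally obtain T where T: "?T \<eta> UNIV = ennreal T" "0 \<le> T" by (cases "?T \<eta> UNIV") auto
    obtain c where c: "C = ennreal c" "0 \<le> c" using C(1) by (cases C) auto
    have "ennreal T \<le> ennreal (c + 1/2 * T)"
    proof -
      have "ennreal (c + 1/2 * T) = ennreal c + ennreal (1/2 * T)"
        using T c by (intro ennreal_plus) auto
      also have "ennreal (1/2 * T) = ennreal (1/2) * ennreal T" by (rule ennreal_mult') simp
      finally show ?thesis using le unfolding T(1) c(1) by simp
    qed
    then have "T \<le> 2 * c" using c(2) T(2) by (subst (asm) ennreal_le_iff) auto
    then have "ennreal T \<le> ennreal (2 * c)" by (rule ennreal_leI)
    then show ?thesis using T c by (simp add: ennreal_mult')
  qed
  have "(\<lambda>k. ?T (1 / real (Suc k)) UNIV)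
      \<longlonglongrightarrow> (\<integral>\<^sup>+x\<in>\<Omega>. ennreal (\<bar>u x\<bar> powr q * infdist x (- \<Omega>) powr (- a)) \<partial>lborel)"
    unfolding truncated_hardy_def
  proof (rule nn_integral_LIMSEQ)
    show "incseq (\<lambda>k x. ennreal (\<bar>u x\<bar> powr q * infdist x (- \<Omega>) powr - a) *
        indicator {x \<in> \<Omega> \<inter> UNIV. 1 / real (Suc k) < infdist x (- \<Omega>)} x)"
    proof (intro incseq_SucI le_funI mult_left_mono)
      fix k x
      have "1 / real (Suc (Suc k)) \<le> 1 / real (Suc k)" by (simp add: field_simps)
      then show "(indicator {x \<in> \<Omega> \<inter> UNIV. 1 / real (Suc k) < infdist x (- \<Omega>)} x :: ennreal)
          \<le> indicator {x \<in> \<Omega> \<inter> UNIV. 1 / real (Suc (Suc k)) < infdist x (- \<Omega>)} x"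
        by (auto simp: indicator_def)
    qed simp
    fix x
    show "(\<lambda>k. ennreal (\<bar>u x\<bar> powr q * infdist x (- \<Omega>) powr - a) *
        indicator {x \<in> \<Omega> \<inter> UNIV. 1 / real (Suc k) < infdist x (- \<Omega>)} x)
        \<longlonglongrightarrow> ennreal (\<bar>u x\<bar> powr q * infdist x (- \<Omega>) powr - a) * indicator \<Omega> x"
    proof (cases "x \<in> \<Omega>")
      case True
      have "0 < infdist x (- \<Omega>)" by (rule infdist_Compl_pos[OF \<Omega>(1,2) True])
      then have "eventually (\<lambda>k. 1 / real (Suc k) < infdist x (- \<Omega>)) sequentially"
        using LIMSEQ_inverse_real_of_nat by (auto dest: order_tendstoD simp: inverse_eq_divide)
      then show ?thesis
        using True by (intro tendsto_eventually) (auto elim!: eventually_mono)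
    qed simp
  qed measurable
  then have "(\<integral>\<^sup>+x\<in>\<Omega>. ennreal (\<bar>u x\<bar> powr q * infdist x (- \<Omega>) powr (- a)) \<partial>lborel) \<le> 2 * C"
    by (rule LIMSEQ_le_const2) (auto intro!: bound)
  also have "\<dots> < \<infinity>" using C(1) by (simp add: ennreal_mult_less_top)
  finally show ?thesis .
qed

section \<open>Integrability of the kernel\<close>

text \<open>
On dyadic shells around \<open>x\<close> the kernel is nearly constant, and their contributions form a geometric series
with ratio \<open>2 powr (-a)\<close>.
\<close>

lemma nn_integral_outside_ball_le:
  assumes "0 < a"
  obtains C where "0 \<le> C" "\<And>(x::'a::euclidean_space) d. 0 < d \<Longrightarrow>
    (\<integral>\<^sup>+y\<in>- ball x d. ennreal (1 / norm (x - y) powr (real DIM('a) + a)) \<partial>lborel) \<le> ennreal (C * d powr (- a))"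
proof -
  let ?n = "DIM('a)"
  define \<omega> where "\<omega> = unit_ball_vol (real ?n)"
  define b where "b = (2::real) powr (- a)"
  have \<omega>: "0 \<le> \<omega>" by (simp add: \<omega>_def)
  have b: "0 < b" "b < 1" using assms by (auto simp: b_def powr_less_one)
  show thesis
  proof (rule that[of "\<omega> * 2 ^ ?n / (1 - b)"])
    show "0 \<le> \<omega> * 2 ^ ?n / (1 - b)" using \<omega> b by simp
    fix x :: 'a and d :: real assume "0 < d"
    \<comment> \<open>\<open>c k\<close> bounds the kernel on the dyadic shell with radii \<open>2 ^ k * d\<close> and \<open>2 ^ Suc k * d\<close>.\<close>
    define c where "c k = (2 ^ k * d) powr (- (real ?n + a))" for k :: nat
    have pw: "ennreal (1 / norm (x - y) powr (real ?n + a)) * indicator (- ball x d) y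
        \<le> (\<Sum>k. ennreal (c k) * indicator (ball x (2 ^ Suc k * d)) y)" for y
    proof (cases "y \<in> ball x d")
      case False
      then have far: "d \<le> dist x y" by simp
      obtain m where "dist x y / d < 2 ^ m" using real_arch_pow[of 2 "dist x y / d"] by auto
      then have ex: "dist x y < 2 ^ m * d" using \<open>0 < d\<close> by (simp add: field_simps)
      define k where "k = (LEAST m. dist x y < 2 ^ m * d) - 1"
      have L: "dist x y < 2 ^ (LEAST m. dist x y < 2 ^ m * d) * d" using ex by (rule LeastI)
      then have "(LEAST m. dist x y < 2 ^ m * d) \<noteq> 0" using far by (intro notI) simp
      then have k: "(LEAST m. dist x y < 2 ^ m * d) = Suc k" by (simp add: k_def)
      then have up: "dist x y < 2 ^ Suc k * d" using L by metis
      have "\<not> dist x y < 2 ^ k * d"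
        using not_less_Least[of k "\<lambda>m. dist x y < 2 ^ m * d"] k by simp
      then have lo: "2 ^ k * d \<le> norm (x - y)" by (simp add: dist_norm)
      have "1 / norm (x - y) powr (real ?n + a) = norm (x - y) powr (- (real ?n + a))"
        by (rule powr_minus_divide[symmetric])
      also have "\<dots> \<le> c k"
        unfolding c_def using lo \<open>0 < d\<close> assms by (intro powr_mono2') auto
      finally have "ennreal (1 / norm (x - y) powr (real ?n + a)) * indicator (- ball x d) y
          \<le> ennreal (c k) * indicator (ball x (2 ^ Suc k * d)) y"
        using up by (auto simp: indicator_def intro: ennreal_leI)
      also have "\<dots> = (\<Sum>k\<in>{k}. ennreal (c k) * indicator (ball x (2 ^ Suc k * d)) y)"
        by (simp del: sum_mult_indicator)
      also have "\<dots> \<le> (\<Sum>k. ennreal (c k) * indicator (ball x (2 ^ Suc k * d)) y)"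
        by (rule sum_le_suminf) auto
      finally show ?thesis .
    qed simp
    have term_eq: "c k * (\<omega> * (2 ^ Suc k * d) ^ ?n) = \<omega> * 2 ^ ?n * d powr (- a) * b ^ k" for k
    proof -
      let ?s = "2 ^ k * d"
      have "?s powr (- (real ?n + a)) * ?s ^ ?n = ?s powr (- a)"
      proof -
        have "?s ^ ?n = ?s powr real ?n" using \<open>0 < d\<close> by (intro powr_realpow[symmetric]) simp
        then show ?thesis by (simp add: powr_add[symmetric])
      qed
      moreover have "?s powr (- a) = b ^ k * d powr (- a)"
      proof -
        have "(2 ^ k) powr (- a) = b ^ k" unfolding b_def by (induction k) (simp_all add: powr_mult)
        then show ?thesis using \<open>0 < d\<close> by (simp add: powr_mult)
      qed
      ultimately show ?thesis
        unfolding c_def by (simp add: power_mult_distrib mult.assoc mult.left_commute)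
    qed
    have [measurable]: "(indicator (ball x \<rho>) :: 'a \<Rightarrow> ennreal) \<in> borel_measurable borel" for \<rho>
      by (rule borel_measurable_indicator) simp
    have "(\<integral>\<^sup>+y\<in>- ball x d. ennreal (1 / norm (x - y) powr (real ?n + a)) \<partial>lborel)
        \<le> (\<integral>\<^sup>+y. (\<Sum>k. ennreal (c k) * indicator (ball x (2 ^ Suc k * d)) y) \<partial>lborel)"
      by (intro nn_integral_mono pw)
    also have "\<dots> = (\<Sum>k. ennreal (c k) * emeasure lborel (ball x (2 ^ Suc k * d)))"
      by (subst nn_integral_suminf)
        (simp_all add: nn_integral_cmult_indicator del: power_Suc)
    also have "\<dots> = (\<Sum>k. ennreal (\<omega> * 2 ^ ?n * d powr (- a) * b ^ k))"
      using \<open>0 < d\<close> \<omega>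
      by (intro suminf_cong) (simp add: emeasure_ball \<omega>_def[symmetric] term_eq[symmetric] c_def ennreal_mult'
          del: power_Suc)
    also have "\<dots> = ennreal (\<omega> * 2 ^ ?n * d powr (- a) * (1 / (1 - b)))"
      using b \<omega> by (intro suminf_ennreal_eq sums_mult geometric_sums) auto
    finally show "(\<integral>\<^sup>+y\<in>- ball x d. ennreal (1 / norm (x - y) powr (real ?n + a)) \<partial>lborel)
        \<le> ennreal (\<omega> * 2 ^ ?n / (1 - b) * d powr (- a))"
      by (simp add: field_simps)
  qed
qed

text \<open>
The complement of \<open>\<Omega>\<close> lies outside the ball around \<open>x\<close> with radius the depth of \<open>x\<close>.
\<close>

lemma nn_integral_kernel_complement_le:
  fixes \<Omega> :: "'a::euclidean_space set"
  assumes "bounded \<Omega>" and \<Omega>: "open \<Omega>" and "0 < a"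
  obtains C where "0 \<le> C" "\<And>x. x \<in> \<Omega> \<Longrightarrow>
    (\<integral>\<^sup>+y\<in>- \<Omega>. ennreal (1 / norm (x - y) powr (real DIM('a) + a)) \<partial>lborel) \<le> ennreal (C * infdist x (- \<Omega>) powr (- a))"
proof -
  obtain C where C: "0 \<le> C" "\<And>(x::'a) d. 0 < d \<Longrightarrow>
    (\<integral>\<^sup>+y\<in>- ball x d. ennreal (1 / norm (x - y) powr (real DIM('a) + a)) \<partial>lborel) \<le> ennreal (C * d powr (- a))"
    using nn_integral_outside_ball_le[OF \<open>0 < a\<close>] by metis
  show thesis
  proof (rule that[OF C(1)])
    fix x assume x: "x \<in> \<Omega>"
    have d: "0 < infdist x (- \<Omega>)" using assms x by (intro infdist_Compl_pos)
    have "(\<integral>\<^sup>+y\<in>- \<Omega>. ennreal (1 / norm (x - y) powr (real DIM('a) + a)) \<partial>lborel)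
        \<le> (\<integral>\<^sup>+y\<in>- ball x (infdist x (- \<Omega>)). ennreal (1 / norm (x - y) powr (real DIM('a) + a)) \<partial>lborel)"
      using infdist_le[of _ "- \<Omega>" x]
      by (intro nn_integral_mono mult_left_mono) (fastforce simp: indicator_def)+
    also note C(2)[OF d]
    finally show "(\<integral>\<^sup>+y\<in>- \<Omega>. ennreal (1 / norm (x - y) powr (real DIM('a) + a)) \<partial>lborel)
        \<le> ennreal (C * infdist x (- \<Omega>) powr (- a))" .
  qed
qed

lemma Q_set_measurable [measurable]:
  fixes \<Omega> :: "'a::euclidean_space set"
  assumes [measurable]: "\<Omega> \<in> sets borel"
  shows "Q_set \<Omega> \<in> sets (lborel \<Otimes>\<^sub>M lborel)"
proof -
  have "space (lborel \<Otimes>\<^sub>M lborel) - (UNIV - \<Omega>) \<times> (UNIV - \<Omega>) \<in> sets (lborel \<Otimes>\<^sub>M lborel)"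
    by (intro sets.compl_sets pair_measureI) auto
  then show ?thesis by (simp add: Q_set_def space_pair_measure)
qed

lemma nn_integral_Q_set_finite:
  fixes \<Omega> :: "'a::euclidean_space set" and u :: "'a \<Rightarrow> real"
  assumes \<Omega>: "bounded \<Omega>" "open \<Omega>" "lipschitz_boundary \<Omega>"
    and u [measurable]: "u \<in> borel_measurable borel" and a: "0 < a" "a < 1" and q: "0 < q"
    and Lq: "(\<integral>\<^sup>+x\<in>\<Omega>. ennreal (\<bar>u x\<bar> powr q) \<partial>lborel) < \<infinity>"
    and semi: "seminorm_powr a q \<Omega> u < \<infinity>"
    and tail: "(\<integral>\<^sup>+x\<in>\<Omega>. (\<integral>\<^sup>+y\<in>- \<Omega>. ennreal (\<bar>u y\<bar> powr q / norm (x - y) powr (real DIM('a) + a)) \<partial>lborel) \<partial>lborel) < \<infinity>"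
  shows "(\<integral>\<^sup>+w\<in>Q_set \<Omega>. ennreal (\<bar>u (fst w) - u (snd w)\<bar> powr q / norm (fst w - snd w) powr (real DIM('a) + a))
     \<partial>(lborel \<Otimes>\<^sub>M lborel)) < \<infinity>"
proof -
  have [measurable]: "\<Omega> \<in> sets borel" using \<Omega>(2) by simp
  define G where "G x y = ennreal (\<bar>u x - u y\<bar> powr q / norm (x - y) powr (real DIM('a) + a))" for x y
  define N where "N x y = 1 / norm (x - y) powr (real DIM('a) + a)" for x y :: 'a
  define U where "U x y = ennreal (\<bar>u y\<bar> powr q / norm (x - y) powr (real DIM('a) + a))" for x y
  have [measurable]: "(\<lambda>(x, y). G x y) \<in> borel_measurable (lborel \<Otimes>\<^sub>M lborel)"
      "(\<lambda>(x, y). N x y) \<in> borel_measurable (lborel \<Otimes>\<^sub>M lborel)"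
      "(\<lambda>(x, y). U x y) \<in> borel_measurable (lborel \<Otimes>\<^sub>M lborel)"
    unfolding G_def N_def U_def by measurable
  have sym: "G x y = G y x" for x y by (simp add: G_def abs_minus_commute norm_minus_commute)
  define X where "X = (\<integral>\<^sup>+x. \<integral>\<^sup>+y. G x y * indicator (- \<Omega>) y * indicator \<Omega> x \<partial>lborel \<partial>lborel)"
  obtain C where C: "0 \<le> C" "\<And>x. x \<in> \<Omega> \<Longrightarrow>
      (\<integral>\<^sup>+y\<in>- \<Omega>. ennreal (N x y) \<partial>lborel) \<le> ennreal (C * infdist x (- \<Omega>) powr (- a))"
    using nn_integral_kernel_complement_le[OF \<Omega>(1,2) a(1)] unfolding N_def by metis
  define H where "H x = ennreal (\<bar>u x\<bar> powr q * infdist x (- \<Omega>) powr (- a))" for x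
  have [measurable]: "H \<in> borel_measurable borel" unfolding H_def by measurable
  have H: "(\<integral>\<^sup>+x\<in>\<Omega>. H x \<partial>lborel) < \<infinity>"
    unfolding H_def by (rule fractional_hardy[OF \<Omega> u a q Lq semi])
  have pw: "G x y \<le> ennreal (2 powr q) * (ennreal (\<bar>u x\<bar> powr q) * ennreal (N x y) + U x y)" for x y
  proof -
    have "\<bar>u x - u y\<bar> powr q \<le> 2 powr q * (\<bar>u x\<bar> powr q + \<bar>u y\<bar> powr q)"
      using abs_powr_triangle_le[of q "u x - u y" "u x"] q by simp
    then have "\<bar>u x - u y\<bar> powr q * N x y \<le> 2 powr q * (\<bar>u x\<bar> powr q + \<bar>u y\<bar> powr q) * N x y"
      by (rule mult_right_mono) (simp add: N_def)
    then have "G x y \<le> ennreal (2 powr q * (\<bar>u x\<bar> powr q * N x y + \<bar>u y\<bar> powr q * N x y))"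
      unfolding G_def by (intro ennreal_leI) (simp add: N_def algebra_simps add_divide_distrib)
    also have "\<dots> = ennreal (2 powr q) * (ennreal (\<bar>u x\<bar> powr q) * ennreal (N x y) + U x y)"
      by (subst ennreal_mult') (auto simp: U_def N_def ennreal_plus simp flip: ennreal_mult')
    finally show ?thesis .
  qed
  have "X \<le> (\<integral>\<^sup>+x. ennreal (2 powr q) * (ennreal C * (H x * indicator \<Omega> x)
      + (\<integral>\<^sup>+y\<in>- \<Omega>. U x y \<partial>lborel) * indicator \<Omega> x) \<partial>lborel)"
    unfolding X_def
  proof (rule nn_integral_mono)
    fix x
    show "(\<integral>\<^sup>+y. G x y * indicator (- \<Omega>) y * indicator \<Omega> x \<partial>lborel)
      \<le> ennreal (2 powr q) * (ennreal C * (H x * indicator \<Omega> x)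
      + (\<integral>\<^sup>+y\<in>- \<Omega>. U x y \<partial>lborel) * indicator \<Omega> x)"
    proof (cases "x \<in> \<Omega>")
      case True
      have "(\<integral>\<^sup>+y. G x y * indicator (- \<Omega>) y \<partial>lborel) \<le>
         (\<integral>\<^sup>+y. ennreal (2 powr q) * (ennreal (\<bar>u x\<bar> powr q) * (ennreal (N x y) * indicator (- \<Omega>) y) + U x y * indicator (- \<Omega>) y) \<partial>lborel)"
        using pw by (intro nn_integral_mono) (auto simp: indicator_def)
      also have "\<dots> = ennreal (2 powr q) * (ennreal (\<bar>u x\<bar> powr q) * (\<integral>\<^sup>+y\<in>- \<Omega>. ennreal (N x y) \<partial>lborel)
          + (\<integral>\<^sup>+y\<in>- \<Omega>. U x y \<partial>lborel))"
        by (simp add: nn_integral_cmult nn_integral_add)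
      also have "\<dots> \<le> ennreal (2 powr q) * (ennreal (\<bar>u x\<bar> powr q) * ennreal (C * infdist x (- \<Omega>) powr (- a))
          + (\<integral>\<^sup>+y\<in>- \<Omega>. U x y \<partial>lborel))"
        by (intro mult_left_mono add_right_mono C(2) True) auto
      also have "ennreal (\<bar>u x\<bar> powr q) * ennreal (C * infdist x (- \<Omega>) powr (- a)) = ennreal C * H x"
        using C(1) by (simp add: H_def mult_ac flip: ennreal_mult')
      finally show ?thesis using True by simp
    qed simp
  qed
  also have "\<dots> = ennreal (2 powr q) * (ennreal C * (\<integral>\<^sup>+x\<in>\<Omega>. H x \<partial>lborel)
      + (\<integral>\<^sup>+x\<in>\<Omega>. (\<integral>\<^sup>+y\<in>- \<Omega>. U x y \<partial>lborel) \<partial>lborel))"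
    by (simp add: nn_integral_cmult nn_integral_add)
  also have "\<dots> < \<infinity>"
    using H tail unfolding U_def by (simp add: ennreal_mult_less_top)
  finally have X: "X < \<infinity>" .
  have X': "(\<integral>\<^sup>+x. \<integral>\<^sup>+y. G x y * indicator \<Omega> y * indicator (- \<Omega>) x \<partial>lborel \<partial>lborel) = X"
    unfolding X_def
    by (subst lborel_pair.Fubini'[symmetric], measurable, subst (1) sym) (simp add: mult_ac)
  have S: "(\<integral>\<^sup>+x. \<integral>\<^sup>+y. G x y * indicator \<Omega> y * indicator \<Omega> x \<partial>lborel \<partial>lborel) = seminorm_powr a q \<Omega> u"
    unfolding seminorm_powr_def G_def[symmetric] by (simp add: nn_integral_multc)
  \<comment> \<open>\<open>Q\<close> splits into the square of \<open>\<Omega>\<close> and two mixed parts, which contribute the same by symmetry.\<close>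
  have "(\<integral>\<^sup>+w\<in>Q_set \<Omega>. G (fst w) (snd w) \<partial>(lborel \<Otimes>\<^sub>M lborel))
      = (\<integral>\<^sup>+x. \<integral>\<^sup>+y. G x y * indicator (Q_set \<Omega>) (x, y) \<partial>lborel \<partial>lborel)"
    by (subst lborel.nn_integral_fst[symmetric]) (simp_all add: case_prod_beta)
  also have "\<dots> \<le> (\<integral>\<^sup>+x. \<integral>\<^sup>+y. G x y * indicator \<Omega> y * indicator \<Omega> x
      + (G x y * indicator (- \<Omega>) y * indicator \<Omega> x + G x y * indicator \<Omega> y * indicator (- \<Omega>) x) \<partial>lborel \<partial>lborel)"
    by (intro nn_integral_mono) (auto simp: Q_set_def indicator_def)
  also have "\<dots> = seminorm_powr a q \<Omega> u + (X + X)"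
    unfolding X'[symmetric] S[symmetric]
    by (simp add: nn_integral_add X' X_def)
  also have "\<dots> < \<infinity>" using X semi by simp
  finally show ?thesis unfolding G_def .
qed

section \<open>Convergence of the energies\<close>

text \<open>
The set where \<open>u\<close> and \<open>v\<close> differ need not be Borel, but the strips over a Borel null set that contains it are
null sets.
\<close>

lemma AE_lborel_pair_eq:
  fixes u v :: "'a::euclidean_space \<Rightarrow> real"
  assumes "AE x in lborel. u x = v x"
  shows "AE w in (lborel :: ('a \<times> 'a) measure). u (fst w) = v (fst w) \<and> u (snd w) = v (snd w)"
proof -
  obtain N where N: "{x \<in> space lborel. \<not> u x = v x} \<subseteq> N" "emeasure lborel N = 0" "N \<in> sets lborel"
    using assms by (rule AE_E)
  have "N \<times> UNIV \<in> null_sets (lborel \<Otimes>\<^sub>M lborel)" "UNIV \<times> N \<in> null_sets (lborel \<Otimes>\<^sub>M lborel)"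
    using N by (auto simp: null_sets_def lborel.emeasure_pair_measure_Times)
  then have "AE w in lborel \<Otimes>\<^sub>M lborel. w \<notin> N \<times> UNIV \<and> w \<notin> UNIV \<times> N"
    by (auto dest!: AE_not_in)
  then show ?thesis
    unfolding lborel_prod by eventually_elim (use N(1) in \<open>auto simp: mem_Times_iff\<close>)
qed

lemma energy_cong_AE:
  fixes u v :: "'a::euclidean_space \<Rightarrow> real"
  assumes "AE x in lborel. u x = v x"
  shows "energy r p u \<Omega> = energy r p v \<Omega>"
proof -
  have "(\<integral>\<^sup>+z\<in>Q_set \<Omega>. ennreal (gagliardo_kernel r p u (fst z) (snd z)) \<partial>lborel)
      = (\<integral>\<^sup>+z\<in>Q_set \<Omega>. ennreal (gagliardo_kernel r p v (fst z) (snd z)) \<partial>lborel)"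
    by (intro nn_integral_cong_AE eventually_mono[OF AE_lborel_pair_eq[OF assms]])
      (simp add: gagliardo_kernel_def)
  then show ?thesis by (simp add: energy_def nn_integral_completion)
qed

lemma energy_tendsto:
  fixes \<Omega> :: "'a::euclidean_space set" and u :: "'a \<Rightarrow> real"
  assumes [measurable]: "u \<in> borel_measurable borel" "\<Omega> \<in> sets borel" and q: "1 < q"
    and fin: "(\<integral>\<^sup>+w\<in>Q_set \<Omega>. ennreal (gagliardo_kernel (s_exp DIM('a) s q) q u (fst w) (snd w)) \<partial>(lborel \<Otimes>\<^sub>M lborel)) < \<infinity>"
  shows "((\<lambda>p. energy (s_exp DIM('a) s p) p u \<Omega>) \<longlongrightarrow> energy s 1 u \<Omega>) (at_right 1)"
proof -
  let ?M = "lborel \<Otimes>\<^sub>M (lborel :: 'a measure)"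
  define h where "h w = gagliardo_kernel s 1 u (fst w) (snd w) * indicator (Q_set \<Omega>) w" for w
  have h0: "0 \<le> h w" for w by (simp add: h_def gagliardo_kernel_def)
  have hm: "h \<in> borel_measurable ?M" unfolding h_def gagliardo_kernel_def by measurable
  have pow: "ennreal (h w powr p) =
      ennreal (gagliardo_kernel (s_exp DIM('a) s p) p u (fst w) (snd w)) * indicator (Q_set \<Omega>) w" if "0 < p" for p w
    using that by (simp add: h_def gagliardo_kernel_s_exp indicator_def)
  have en: "energy (s_exp DIM('a) s p) p u \<Omega> = ennreal (1 / (2 * p)) * (\<integral>\<^sup>+w. ennreal (h w powr p) \<partial>?M)" if "0 < p" for p
    using that by (simp add: energy_def nn_integral_completion pow lborel_prod)
  have en1: "energy s 1 u \<Omega> = ennreal (1 / (2 * 1)) * (\<integral>\<^sup>+w. ennreal (h w) \<partial>?M)"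
    using en[of 1] h0 by (simp add: s_exp_def)
  have "((\<lambda>p. \<integral>\<^sup>+w. ennreal (h w powr p) \<partial>?M) \<longlongrightarrow> (\<integral>\<^sup>+w. ennreal (h w) \<partial>?M)) (at_right 1)"
    using fin q by (intro nn_integral_powr_tendsto[OF hm h0 q]) (simp add: pow)
  then have "((\<lambda>p. ennreal (1 / (2 * p)) * (\<integral>\<^sup>+w. ennreal (h w powr p) \<partial>?M))
      \<longlongrightarrow> ennreal (1 / (2 * 1)) * (\<integral>\<^sup>+w. ennreal (h w) \<partial>?M)) (at_right 1)"
    by (intro tendsto_mult_ennreal tendsto_ennrealI tendsto_intros) auto
  moreover have "eventually (\<lambda>p. ennreal (1 / (2 * p)) * (\<integral>\<^sup>+w. ennreal (h w powr p) \<partial>?M)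
      = energy (s_exp DIM('a) s p) p u \<Omega>) (at_right 1)"
    using eventually_at_right_less[of "1::real"] by eventually_elim (simp add: en)
  ultimately show ?thesis unfolding en1 by (rule Lim_transform_eventually)
qed

theorem theorem7p1:
  fixes \<Omega> :: "(real ^ 'n) set" and u :: "real ^ 'n \<Rightarrow> real" and s c q :: real
  assumes s: "s \<in> {0<..<1}"
    and Omega: "bounded \<Omega>" "open \<Omega>" "lipschitz_boundary \<Omega>"
    and c: "\<forall>p\<in>{1<..<c}. s_exp CARD('n) s p \<in> {s<..<1} \<and> s_exp CARD('n) s p * p < 1"
    and q: "q \<in> {1<..<c}"
    and u: "u \<in> W_space (s_exp CARD('n) s q) q \<Omega>"
    and tails: "Tail s 1 \<Omega> u \<in> L1_on \<Omega>" "Tail (s_exp CARD('n) s q) q \<Omega> u \<in> L1_on \<Omega>"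
  shows "((\<lambda>p. energy (s_exp CARD('n) s p) p u \<Omega>) \<longlongrightarrow> energy s 1 u \<Omega>) (at_right 1)"
proof -
  have dim: "DIM(real ^ 'n) = CARD('n)" by simp
  define \<sigma> where "\<sigma> = s_exp CARD('n) s q"
  define a where "a = \<sigma> * q"
  have q1: "1 < q" using q by simp
  have "s < \<sigma>" "a < 1" using c q by (auto simp: a_def \<sigma>_def)
  then have a: "0 < a" "a < 1" using s q1 by (auto simp: a_def)
  \<comment> \<open>Tonelli needs a Borel function; every integral involved sees \<open>u\<close> only up to null sets.\<close>
  obtain v where v [measurable]: "v \<in> borel_measurable borel" and uv: "AE x in lborel. u x = v x"
    using u completion_ex_borel_measurable_real[of u lborel] by (auto simp: W_space_def)
  have m: "\<Omega> \<in> sets borel" using Omega(2) by simp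
  have Lq: "(\<integral>\<^sup>+x\<in>\<Omega>. ennreal (\<bar>v x\<bar> powr q) \<partial>lborel) < \<infinity>"
  proof -
    have "(\<integral>\<^sup>+x\<in>\<Omega>. ennreal (\<bar>v x\<bar> powr q) \<partial>lborel)
        = (\<integral>\<^sup>+x. ennreal (norm (indicator \<Omega> x *\<^sub>R \<bar>u x\<bar> powr q)) \<partial>lborel)"
      using uv by (intro nn_integral_cong_AE) (auto simp: indicator_def elim!: eventually_mono)
    also have "\<dots> < \<infinity>"
      using u by (simp add: W_space_def set_integrable_def integrable_iff_bounded nn_integral_completion)
    finally show ?thesis .
  qed
  have semi: "seminorm_powr a q \<Omega> v < \<infinity>"
  proof -
    have "seminorm_powr a q \<Omega> v = (\<integral>\<^sup>+x\<in>\<Omega>. (\<integral>\<^sup>+y\<in>\<Omega>. ennreal (gagliardo_kernel \<sigma> q u x y) \<partial>lborel) \<partial>lborel)"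
      unfolding seminorm_powr_def gagliardo_kernel_def a_def
    proof (rule nn_integral_cong_AE, use uv in eventually_elim)
      fix x assume "u x = v x"
      then have "(\<integral>\<^sup>+y\<in>\<Omega>. ennreal (\<bar>v x - v y\<bar> powr q / norm (x - y) powr (real DIM(real ^ 'n) + \<sigma> * q)) \<partial>lborel)
        = (\<integral>\<^sup>+y\<in>\<Omega>. ennreal (\<bar>u x - u y\<bar> powr q / norm (x - y) powr (real DIM(real ^ 'n) + \<sigma> * q)) \<partial>lborel)"
        using uv by (intro nn_integral_cong_AE) (auto elim!: eventually_mono)
      then show "(\<integral>\<^sup>+y\<in>\<Omega>. ennreal (\<bar>v x - v y\<bar> powr q / norm (x - y) powr (real DIM(real ^ 'n) + \<sigma> * q)) \<partial>lborel) * indicator \<Omega> x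
        = (\<integral>\<^sup>+y\<in>\<Omega>. ennreal (\<bar>u x - u y\<bar> powr q / norm (x - y) powr (real DIM(real ^ 'n) + \<sigma> * q)) \<partial>lborel) * indicator \<Omega> x"
        by simp
    qed
    also have "\<dots> < \<infinity>" using u by (simp add: W_space_def \<sigma>_def nn_integral_completion)
    finally show ?thesis .
  qed
  have tail: "(\<integral>\<^sup>+x\<in>\<Omega>. (\<integral>\<^sup>+y\<in>- \<Omega>. ennreal (\<bar>v y\<bar> powr q / norm (x - y) powr (real DIM(real ^ 'n) + a)) \<partial>lborel) \<partial>lborel) < \<infinity>"
  proof -
    have "(\<integral>\<^sup>+y\<in>- \<Omega>. ennreal (\<bar>v y\<bar> powr q / norm (x - y) powr (real DIM(real ^ 'n) + a)) \<partial>lborel) = Tail \<sigma> q \<Omega> u x" for x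
      unfolding Tail_def nn_integral_completion a_def
      using uv by (intro nn_integral_cong_AE) (auto elim!: eventually_mono)
    then show ?thesis using tails(2) by (simp add: L1_on_def \<sigma>_def nn_integral_completion)
  qed
  have "(\<integral>\<^sup>+w\<in>Q_set \<Omega>. ennreal (gagliardo_kernel (s_exp DIM(real ^ 'n) s q) q v (fst w) (snd w))
     \<partial>(lborel \<Otimes>\<^sub>M lborel)) < \<infinity>"
    using nn_integral_Q_set_finite[OF Omega v a _ Lq semi tail] q1
    by (simp add: gagliardo_kernel_def a_def \<sigma>_def)
  then have "((\<lambda>p. energy (s_exp CARD('n) s p) p v \<Omega>) \<longlongrightarrow> energy s 1 v \<Omega>) (at_right 1)"
    unfolding dim[symmetric] by (rule energy_tendsto[OF v m q1])
  then show ?thesis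
    by (simp only: energy_cong_AE[OF uv])
qed

end
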